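(* Let $N\ge1$, let $p\ge1$ be an integer and let $D$ be a countable dense subset of $\mathbb R^{2N}$. Let $E\subset\mathfrak{LC}_p(\mathbb R^{2N},\mathbb R^N)$ have $L^1_{loc}$-bounded $l$-bounds, let $(f_n)_{n\in\mathbb N}$ be a sequence in $E$ converging to $f$ in $(\mathfrak{LC}_p(\mathbb R^{2N},\mathbb R^N),\mathcal T_D)$, and let $(\phi_n)_{n\in\mathbb N}$ be a sequence in $\mathcal C=C([-1,0],\mathbb R^N)$ converging uniformly to $\phi\in\mathcal C$. Then $$x(\cdot,f_n,\phi_n)\xrightarrow{n\to\infty}x(\cdot,f,\phi)$$ uniformly in any $[-1,T]\subset I_{f,\phi}$.
   Context: $B_j$ is the closed ball of radius $j$ centered at the origin. $L^p_{loc}$ is the set of real functions on $\mathbb R$ belonging to $L^p(I)$ for every compact interval $I$. $\mathfrak{LC}_p(\mathbb R^{2N},\mathbb R^N)$ is the set of functions $f:\mathbb R\times\mathbb R^{2N}\to\mathbb R^N$ such that: $f$ is Borel measurable; for every compact $K\subset\mathbb R^{2N}$ there are $m^K,l^K\in L^p_{loc}$ such that for a.e. $t\in\mathbb R$, $|f(t,z)|\le m^K(t)$ and $|f(t,z_1)-f(t,z_2)|\le l^K(t)|z_1-z_2|$ for all $z,z_1,z_2\in K$. Functions differing only on a negligible set are identified. The optimal $l$-bound of $f$ on $B_j\subset\mathbb R^{2N}$ is $l_f^j(t)=\sup_{z_1\ne z_2\in B_j}|f(t,z_1)-f(t,z_2)|/|z_1-z_2|$. $E$ has $L^1_{loc}$-bounded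 $l$-bounds if $\sup_{f\in E}\int_{-r}^r l_f^j(t)\,dt<\infty$ for every $j\in\mathbb N$ and $r>0$. $\mathcal T_D$ is the topology generated by the seminorms $p_{I,z}(f)=\left[\int_I|f(t,z)|^pdt\right]^{1/p}$, $z\in D$, $I=[q_1,q_2]$, $q_1,q_2\in\mathbb Q$. For $f\in\mathfrak{LC}_p(\mathbb R^{2N},\mathbb R^N)$ and $\phi\in\mathcal C$, $x(\cdot,f,\phi)$ denotes the unique maximal continuous (Carathéodory) solution, with maximal interval of definition $I_{f,\phi}=[-1,b_{f,\phi})$, of $\dot x=f(t,x(t),x(t-1))$ for $t>0$, $x(t)=\phi(t)$ for $t\in[-1,0]$; if $b_{f,\phi}<\infty$ then $|x(t,f,\phi)|\to\infty$ as $t\to b_{f,\phi}$. Convergence on $[-1,T]$ is understood for $n$ large enough that $[-1,T]\subset I_{f_n,\phi_n}$, this being part of the assertion. *)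

theory Defs
  imports "HOL-Analysis.Analysis"
begin

text \<open>\<^typ>\<open>real ^ 'n\<close> renders $R^N$ and the product type \<^typ>\<open>(real ^ 'n) \<times> (real ^ 'n)\<close>
  renders $R^{2N}$; the norm of the product type is the Euclidean one.  Elements of
  $L^p_{loc}$ and of \<open>LC p\<close> are represented by functions rather than by classes modulo
  null sets.\<close>

type_synonym 'n rhs = "real \<times> (real ^ 'n) \<times> (real ^ 'n) \<Rightarrow> real ^ 'n"

definition Lp_loc :: "nat \<Rightarrow> (real \<Rightarrow> real) set" where
  "Lp_loc p = {m. m \<in> borel_measurable lebesgue \<and>
     (\<forall>a b. set_integrable lebesgue {a..b} (\<lambda>t. \<bar>m t\<bar> ^ p))}"

definition LC :: "nat \<Rightarrow> ('n::finite) rhs set" where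
  "LC p = {f. f \<in> borel_measurable borel \<and>
     (\<forall>K. compact K \<longrightarrow> (\<exists>m\<in>Lp_loc p. \<exists>l\<in>Lp_loc p. AE t in lebesgue.
        (\<forall>z\<in>K. norm (f (t, z)) \<le> m t) \<and>
        (\<forall>z1\<in>K. \<forall>z2\<in>K. norm (f (t, z1) - f (t, z2)) \<le> l t * norm (z1 - z2))))}"

text \<open>The optimal \<open>l\<close>-bound takes values in \<^typ>\<open>ennreal\<close>: it may be infinite for \<open>t\<close> in a
  null set, and the supremum over the empty set (case \<open>j = 0\<close>) is \<open>0\<close>.\<close>

definition opt_l_bound :: "('n::finite) rhs \<Rightarrow> nat \<Rightarrow> real \<Rightarrow> ennreal" where
  "opt_l_bound f j t =
     (SUP (z1, z2) \<in> {(z1, z2). z1 \<in> cball 0 (real j) \<and> z2 \<in> cball 0 (real j) \<and> z1 \<noteq> z2}.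
        ennreal (norm (f (t, z1) - f (t, z2)) / norm (z1 - z2)))"

definition L1_loc_bounded_l_bounds :: "('n::finite) rhs set \<Rightarrow> bool" where
  "L1_loc_bounded_l_bounds E \<longleftrightarrow>
     (\<forall>j. \<forall>r>0. (SUP f\<in>E. \<integral>\<^sup>+t\<in>{-r..r}. opt_l_bound f j t \<partial>lebesgue) < \<infinity>)"

definition TD_seminorm ::
    "nat \<Rightarrow> real \<Rightarrow> real \<Rightarrow> (real ^ 'n) \<times> (real ^ 'n) \<Rightarrow> ('n::finite) rhs \<Rightarrow> real" where
  "TD_seminorm p q1 q2 z f = root p (LINT t:{q1..q2}|lebesgue. norm (f (t, z)) ^ p)"

text \<open>The topology on \<open>LC p\<close> generated by the seminorms: the open seminorm balls form a
  subbase.\<close>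

definition TD_topology ::
    "nat \<Rightarrow> ((real ^ 'n) \<times> (real ^ 'n)) set \<Rightarrow> ('n::finite) rhs topology" where
  "TD_topology p D = topology_generated_by
     {{g \<in> LC p. TD_seminorm p q1 q2 z (\<lambda>u. g u - f u) < e} | f q1 q2 z e.
        f \<in> LC p \<and> q1 \<in> \<rat> \<and> q2 \<in> \<rat> \<and> q1 \<le> q2 \<and> z \<in> D \<and> 0 < e}"

text \<open>A set of pairs stands for a finite family of non-overlapping intervals.\<close>

definition abs_continuous_on :: "real set \<Rightarrow> (real \<Rightarrow> 'a::real_normed_vector) \<Rightarrow> bool" where
  "abs_continuous_on S x \<longleftrightarrow>
     (\<forall>e>0. \<exists>d>0. \<forall>P. finite P \<and>
        (\<forall>(a, b)\<in>P. a < b \<and> {a..b} \<subseteq> S) \<and>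
        pairwise (\<lambda>(a, b) (a', b'). {a<..<b} \<inter> {a'<..<b'} = {}) P \<and>
        (\<Sum>(a, b)\<in>P. b - a) < d
        \<longrightarrow> (\<Sum>(a, b)\<in>P. norm (x b - x a)) < e)"

definition sol_interval :: "ereal \<Rightarrow> real set" where
  "sol_interval b = {t. -1 \<le> t \<and> ereal t < b}"

text \<open>\<open>dde_solution f \<phi> b x\<close>: the function \<open>x\<close> is a Caratheodory solution on \<open>[-1, b)\<close>, where
  \<open>0 < b \<le> \<infinity>\<close>, of $x'(t) = f(t, x(t), x(t-1))$, $t > 0$, with $x = \phi$ on $[-1, 0]$.  The
  values of \<open>x\<close> outside \<open>[-1, b)\<close> and those of \<open>\<phi>\<close> outside \<open>[-1, 0]\<close> are irrelevant.\<close>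

definition dde_solution ::
    "('n::finite) rhs \<Rightarrow> (real \<Rightarrow> real ^ 'n) \<Rightarrow> ereal \<Rightarrow> (real \<Rightarrow> real ^ 'n) \<Rightarrow> bool" where
  "dde_solution f \<phi> b x \<longleftrightarrow>
     0 < b \<and>
     continuous_on (sol_interval b) x \<and>
     (\<forall>t\<in>{-1..0}. x t = \<phi> t) \<and>
     (\<forall>T>0. ereal T < b \<longrightarrow> abs_continuous_on {0..T} x) \<and>
     (AE t in lebesgue. 0 < t \<and> ereal t < b \<longrightarrow>
        (x has_vector_derivative f (t, x t, x (t - 1))) (at t))"

definition maximal_dde_solution ::
    "('n::finite) rhs \<Rightarrow> (real \<Rightarrow> real ^ 'n) \<Rightarrow> ereal \<Rightarrow> (real \<Rightarrow> real ^ 'n) \<Rightarrow> bool" where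
  "maximal_dde_solution f \<phi> b x \<longleftrightarrow>
     dde_solution f \<phi> b x \<and>
     \<not> (\<exists>b' y. b < b' \<and> dde_solution f \<phi> b' y \<and> (\<forall>t\<in>sol_interval b. y t = x t))"

end

theory Submission
  imports Defs
begin

text \<open>A Gronwall estimate compares the solutions \<open>X n\<close> and \<open>x\<close> directly: the kernel is the
  \<open>l\<close>-bound of \<open>F n\<close>, whose integrals are bounded uniformly in \<open>n\<close>, and the inhomogeneity is
  $\|\Phi_n - \phi\|_\infty + \int_0^T |F_n - f|(s, x(s), x(s-1))\,ds$.  The last integral tends to
  $0$: the path $s \mapsto (x(s), x(s-1))$ has compact range, so it stays close to a finite subset
  of \<open>D\<close>, on which the seminorms control $F_n - f$, and the \<open>l\<close>-bounds control the error.  The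
  estimate needs \<open>X n\<close> near \<open>x\<close>, which a first-exit argument supplies, and it excludes
  blow-up before \<open>T\<close> because a bounded solution on a bounded interval can be continued.\<close>

subsection \<open>Absolutely continuous functions and Lebesgue differentiation\<close>

text \<open>\<open>TD_topology\<close> only sees arguments \<open>z\<close> frozen in time, whereas
  the equation evaluates the right-hand side along a moving path. The difference of the two
  velocities is therefore split as $[F_n(X_n) - F_n(x)] + [F_n(x) - f(x)]$: the second bracket
  involves only the fixed path of \<open>x\<close>, and the first is estimated with the kernel of
  \<open>F n\<close>. Only the total mass of that kernel enters, through the exponential in the
  Gronwall bound, so the kernels may vary with \<open>n\<close> without a common majorant.
  \<open>dde_solution\<close> speaks of absolute continuity and an a.e. derivative, the estimates of
  integral equations. The fundamental theorem for absolutely continuous functions translates one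
  way; Lebesgue differentiation translates back and certifies that a continued function is again a
  solution. Maximality enters only as the absence of such a continuation. The supremum in
  \<open>opt_l_bound\<close> runs over an uncountable set, so measurability in \<open>t\<close> is
  not evident; a countable supremum below it supplies the kernel.\<close>

text \<open>Isolates the part of \<open>abs_continuous_on\<close> that mentions neither
  \<open>S\<close> nor the total length, so that it can be fed to the facts on divisions.\<close>

definition nonoverlapping :: "(real \<times> real) set \<Rightarrow> bool" where
  "nonoverlapping P \<longleftrightarrow> finite P \<and> (\<forall>(a, b)\<in>P. a < b) \<and>
     pairwise (\<lambda>(a, b) (a', b'). {a<..<b} \<inter> {a'<..<b'} = {}) P"

lemma abs_continuous_on_iff:
  "abs_continuous_on S x \<longleftrightarrow>
     (\<forall>e>0. \<exists>d>0. \<forall>P. nonoverlapping P \<and> (\<forall>(a, b)\<in>P. {a..b} \<subseteq> S) \<and> (\<Sum>(a, b)\<in>P. b - a) < d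
        \<longrightarrow> (\<Sum>(a, b)\<in>P. norm (x b - x a)) < e)"
proof -
  have "finite P \<and> (\<forall>(a, b)\<in>P. a < b \<and> {a..b} \<subseteq> S) \<and>
        pairwise (\<lambda>(a, b) (a', b'). {a<..<b} \<inter> {a'<..<b'} = {}) P \<and> (\<Sum>(a, b)\<in>P. b - a) < d
     \<longleftrightarrow> nonoverlapping P \<and> (\<forall>(a, b)\<in>P. {a..b} \<subseteq> S) \<and> (\<Sum>(a, b)\<in>P. b - a) < d" for P d
    unfolding nonoverlapping_def by blast
  then show ?thesis
    unfolding abs_continuous_on_def by simp
qed

text \<open>Bridge from families of endpoint pairs to divisions by sets. Since \<open>a < b\<close>
  is strict, every interval is nonempty and determines its endpoints, so sums can be reindexed
  between the two.\<close>

lemma nonoverlapping_division: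
  assumes "nonoverlapping P"
  shows "(\<lambda>(a, b). {a..b}) ` P division_of (\<Union>(a, b)\<in>P. {a..b})"
    and "inj_on (\<lambda>(a, b). {a..b}) P"
proof -
  have lt: "a < b" if "(a, b) \<in> P" for a b
    using assms that by (auto simp: nonoverlapping_def)
  show "inj_on (\<lambda>(a, b). {a..b}) P"
    by (rule inj_onI) (use lt in \<open>fastforce simp: Icc_eq_Icc\<close>)
  have disj: "{a<..<b} \<inter> {a'<..<b'} = {}"
    if "(a, b) \<in> P" "(a', b') \<in> P" "(a, b) \<noteq> (a', b')" for a b a' b'
    using assms that by (auto simp: nonoverlapping_def pairwise_def)
  show "(\<lambda>(a, b). {a..b}) ` P division_of (\<Union>(a, b)\<in>P. {a..b})"
    unfolding division_of_def
  proof (intro conjI ballI impI)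
    show "finite ((\<lambda>(a, b). {a..b}) ` P)"
      using assms by (auto simp: nonoverlapping_def)
    fix K assume "K \<in> (\<lambda>(a, b). {a..b}) ` P"
    then obtain a b where K: "K = {a..b}" "(a, b) \<in> P" by auto
    show "K \<subseteq> (\<Union>(a, b)\<in>P. {a..b})" "K \<noteq> {}" "\<exists>a b. K = cbox a b"
      using K lt[OF K(2)] by auto
    fix K' assume "K' \<in> (\<lambda>(a, b). {a..b}) ` P" "K \<noteq> K'"
    then obtain a' b' where K': "K' = {a'..b'}" "(a', b') \<in> P" by auto
    show "interior K \<inter> interior K' = {}"
      using disj[OF K(2) K'(2)] \<open>K \<noteq> K'\<close> K K' by auto
  qed auto
qed

lemma sum_integral_nonoverlapping_le:
  fixes g :: "real \<Rightarrow> real"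
  assumes P: "nonoverlapping P" "\<forall>(a, b)\<in>P. {a..b} \<subseteq> {c..d}"
    and g: "g integrable_on {c..d}" "\<And>t. t \<in> {c..d} \<Longrightarrow> 0 \<le> g t"
  shows "(\<Sum>(a, b)\<in>P. integral {a..b} g) \<le> integral {c..d} g"
proof -
  let ?D = "(\<lambda>(a, b). {a..b}) ` P" and ?U = "\<Union>(a, b)\<in>P. {a..b}"
  note D = nonoverlapping_division[OF P(1)]
  have sub: "?U \<subseteq> {c..d}" using P(2) by blast
  have int: "g integrable_on ?U"
    using integrable_on_subdivision[OF D(1) g(1) sub] .
  have "(\<Sum>(a, b)\<in>P. integral {a..b} g) = (\<Sum>K\<in>?D. integral K g)"
    by (subst sum.reindex[OF D(2)]) (simp add: case_prod_unfold)
  also have "\<dots> = integral ?U g"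
  proof (rule integral_combine_division_bottomup[OF D(1), symmetric])
    fix K assume "K \<in> ?D"
    then show "g integrable_on K"
      using P(2) integrable_subinterval_real[OF g(1)] by fastforce
  qed
  also have "\<dots> \<le> integral {c..d} g"
    by (rule integral_subset_le[OF sub int g(1)]) (use g(2) in auto)
  finally show ?thesis .
qed

text \<open>Dominated convergence of the truncations \<open>min (g t) (real k)\<close>. It splits
  \<open>g\<close> into a bounded part and a part of small integral, which is how absolute
  continuity of the integral is obtained.\<close>

lemma integral_uniformly_small_above:
  fixes g :: "real \<Rightarrow> real"
  assumes g: "g integrable_on {c..d}" "\<And>t. t \<in> {c..d} \<Longrightarrow> 0 \<le> g t" and "e > 0"
  obtains k :: nat where "(\<lambda>t. g t - min (g t) (real k)) integrable_on {c..d}"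
    "integral {c..d} (\<lambda>t. g t - min (g t) (real k)) < e"
proof -
  have ai: "g absolutely_integrable_on {c..d}"
    using g by (intro nonnegative_absolutely_integrable_1)
  have mi: "(\<lambda>t. min (g t) (real k)) integrable_on {c..d}" for k
    using absolutely_integrable_min_1[OF ai, of "\<lambda>_. real k"]
    by (auto simp: absolutely_integrable_on_def)
  have "(\<lambda>k. integral {c..d} (\<lambda>t. min (g t) (real k))) \<longlonglongrightarrow> integral {c..d} g"
  proof (rule dominated_convergence(2)[where h = g])
    fix t :: real assume t: "t \<in> {c..d}"
    obtain n :: nat where "g t \<le> real n" using real_arch_simple by blast
    then have "\<forall>\<^sub>F k in sequentially. min (g t) (real k) = g t"
      unfolding eventually_sequentially by (intro exI[of _ n]) auto
    then show "(\<lambda>k. min (g t) (real k)) \<longlonglongrightarrow> g t"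
      by (rule tendsto_eventually)
  qed (use mi g in auto)
  then have "\<forall>\<^sub>F k in sequentially. dist (integral {c..d} (\<lambda>t. min (g t) (real k))) (integral {c..d} g) < e"
    using \<open>e > 0\<close> by (simp add: tendsto_iff)
  then obtain k where k: "dist (integral {c..d} (\<lambda>t. min (g t) (real k))) (integral {c..d} g) < e"
    by (auto simp: eventually_sequentially)
  show thesis
  proof
    show "(\<lambda>t. g t - min (g t) (real k)) integrable_on {c..d}"
      by (intro integrable_diff g mi)
    show "integral {c..d} (\<lambda>t. g t - min (g t) (real k)) < e"
      using k by (simp add: integral_diff[OF g(1) mi] dist_real_def)
  qed
qed

lemma abs_continuous_on_indefinite_integral:
  fixes G :: "real \<Rightarrow> 'a::euclidean_space"
  assumes G: "G absolutely_integrable_on {c..d}"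
  shows "abs_continuous_on {c..d} (\<lambda>t. x0 + integral {c..t} G)"
  unfolding abs_continuous_on_iff
proof (intro allI impI)
  fix e :: real assume "e > 0"
  let ?g = "\<lambda>t. norm (G t)"
  have Gi: "G integrable_on {c..d}" and gi: "?g integrable_on {c..d}"
    using G by (auto simp: absolutely_integrable_on_def)
  obtain k :: nat where k: "(\<lambda>t. ?g t - min (?g t) (real k)) integrable_on {c..d}"
      "integral {c..d} (\<lambda>t. ?g t - min (?g t) (real k)) < e / 2"
    using integral_uniformly_small_above[OF gi, of "e/2"] \<open>e > 0\<close> by auto
  show "\<exists>\<delta>>0. \<forall>P. nonoverlapping P \<and> (\<forall>(a, b)\<in>P. {a..b} \<subseteq> {c..d}) \<and> (\<Sum>(a, b)\<in>P. b - a) < \<delta> \<longrightarrow>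
      (\<Sum>(a, b)\<in>P. norm (x0 + integral {c..b} G - (x0 + integral {c..a} G))) < e"
  \<comment> \<open>The part of \<open>G\<close> below height \<open>k\<close> contributes at most
    \<open>k\<close> times the total length, hence at most \<open>e / 2\<close>; the excess above
    \<open>k\<close> contributes less than \<open>e / 2\<close> on any family. Using
    \<open>k + 1\<close> avoids dividing by zero.\<close>
  proof (intro exI[of _ "e / (2 * (real k + 1))"] conjI allI impI)
    show "e / (2 * (real k + 1)) > 0" using \<open>e > 0\<close> by simp
    fix P assume P: "nonoverlapping P \<and> (\<forall>(a, b)\<in>P. {a..b} \<subseteq> {c..d}) \<and>
        (\<Sum>(a, b)\<in>P. b - a) < e / (2 * (real k + 1))"
    have *: "norm (x0 + integral {c..b} G - (x0 + integral {c..a} G))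
        \<le> integral {a..b} (\<lambda>t. ?g t - min (?g t) (real k)) + real k * (b - a)"
      if "(a, b) \<in> P" for a b
    proof -
      have "a < b" "{a..b} \<subseteq> {c..d}"
        using that P by (auto simp: nonoverlapping_def)
      then have ab: "c \<le> a" "a < b" "b \<le> d" by auto
      have "integral {c..a} G + integral {a..b} G = integral {c..b} G"
        using ab by (intro Henstock_Kurzweil_Integration.integral_combine integrable_subinterval_real[OF Gi]) auto
      then have "norm (x0 + integral {c..b} G - (x0 + integral {c..a} G)) = norm (integral {a..b} G)"
        by (simp add: algebra_simps flip: \<open>_ = integral {c..b} G\<close>)
      also have "\<dots> \<le> integral {a..b} (\<lambda>t. (?g t - min (?g t) (real k)) + real k)"
        using ab by (intro Henstock_Kurzweil_Integration.integral_norm_bound_integral integrable_add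
            integrable_subinterval_real[OF Gi] integrable_subinterval_real[OF k(1)]) auto
      also have "\<dots> = integral {a..b} (\<lambda>t. ?g t - min (?g t) (real k)) + real k * (b - a)"
        using ab by (subst integral_add) (auto intro: integrable_subinterval_real[OF k(1)])
      finally show ?thesis .
    qed
    have "(\<Sum>(a, b)\<in>P. norm (x0 + integral {c..b} G - (x0 + integral {c..a} G)))
        \<le> (\<Sum>(a, b)\<in>P. integral {a..b} (\<lambda>t. ?g t - min (?g t) (real k)) + real k * (b - a))"
      by (rule sum_mono) (use * in auto)
    also have "\<dots> = (\<Sum>(a, b)\<in>P. integral {a..b} (\<lambda>t. ?g t - min (?g t) (real k))) + real k * (\<Sum>(a, b)\<in>P. b - a)"
      by (simp add: case_prod_unfold sum.distrib sum_distrib_left)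
    also have "(\<Sum>(a, b)\<in>P. integral {a..b} (\<lambda>t. ?g t - min (?g t) (real k))) < e / 2"
      using P k by (intro le_less_trans[OF sum_integral_nonoverlapping_le]) auto
    also have "real k * (\<Sum>(a, b)\<in>P. b - a) \<le> real k * (e / (2 * (real k + 1)))"
      using P by (intro mult_left_mono) auto
    also have "e / 2 + real k * (e / (2 * (real k + 1))) \<le> e"
      using \<open>e > 0\<close> by (simp add: field_simps)
    finally show "(\<Sum>(a, b)\<in>P. norm (x0 + integral {c..b} G - (x0 + integral {c..a} G))) < e"
      by simp
  qed
qed


section \<open>Lebesgue differentiation of indefinite integrals\<close>

lemma integral_diff_subinterval:
  fixes G :: "real \<Rightarrow> 'a::euclidean_space"
  assumes "G integrable_on {c..d}" "c \<le> s" "s \<le> t" "t \<le> d"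
  shows "integral {s..t} G = integral {c..t} G - integral {c..s} G"
proof -
  have "integral {c..s} G + integral {s..t} G = integral {c..t} G"
    using assms by (intro Henstock_Kurzweil_Integration.integral_combine integrable_subinterval_real[OF assms(1)]) auto
  then show ?thesis by (simp add: algebra_simps)
qed

text \<open>Around each bad point there are arbitrarily short intervals on which the Riemann term errs by
  more than \<open>e\<close> times the length; Vitali's theorem makes them disjoint and Henstock's lemma bounds
  their total error.\<close>

lemma negligible_indefinite_integral_difference_quotient:
  fixes G :: "real \<Rightarrow> 'a::euclidean_space"
  assumes G: "G integrable_on {c..d}" and "e > 0"
  defines "F \<equiv> \<lambda>t. integral {c..t} G"
  shows "negligible {t \<in> {c<..<d}. \<forall>\<delta>>0. \<exists>y. y \<noteq> t \<and> \<bar>y - t\<bar> < \<delta> \<and>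
            e * \<bar>y - t\<bar> < norm (F y - F t - (y - t) *\<^sub>R G t)}" (is "negligible ?N")
  unfolding negligible_outer_le
proof (intro allI impI)
  fix \<epsilon> :: real assume "\<epsilon> > 0"
  \<comment> \<open>The tag \<open>t\<close> is one end of the interval, and \<open>y\<close> may
    lie on either side of it.\<close>
  define I where "I = (\<lambda>(t, y). {min t y..max t y :: real})"
  have *: "norm (Henstock_Kurzweil_Integration.content (I (t, y)) *\<^sub>R G t - integral (I (t, y)) G)
      = norm (F y - F t - (y - t) *\<^sub>R G t)"
    if "t \<in> {c..d}" "y \<in> {c..d}" for t y
  proof (cases "t \<le> y")
    case True
    then show ?thesis
      using that integral_diff_subinterval[OF G, of t y]
      by (simp add: I_def F_def norm_minus_commute)
  next
    case False
    have "(t - y) *\<^sub>R G t - (F t - F y) = F y - F t - (y - t) *\<^sub>R G t"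
      by (simp add: algebra_simps)
    moreover have "Henstock_Kurzweil_Integration.content (I (t, y)) = t - y" "integral (I (t, y)) G = F t - F y"
      using False that integral_diff_subinterval[OF G, of y t] by (simp_all add: I_def F_def)
    ultimately show ?thesis
      by (simp only:)
  qed
  obtain \<gamma> where \<gamma>: "gauge \<gamma>" and hen: "\<And>p. \<lbrakk>p tagged_partial_division_of {c..d}; \<gamma> fine p\<rbrakk> \<Longrightarrow>
      (\<Sum>(x, k)\<in>p. norm (Henstock_Kurzweil_Integration.content k *\<^sub>R G x - integral k G)) < e * \<epsilon>"
    using Henstock_lemma[of G c d "e * \<epsilon>"] G \<open>e > 0\<close> \<open>\<epsilon> > 0\<close> by auto
  \<comment> \<open>The Vitali family is indexed by tag and other endpoint together, so that a
    selected interval remembers its tag. Each member fits the gauge and has error above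
    \<open>e\<close> times its length.\<close>
  define K where "K = {(t, y). t \<in> ?N \<and> y \<in> {c..d} \<and> y \<noteq> t \<and> I (t, y) \<subseteq> \<gamma> t \<and>
      e * \<bar>y - t\<bar> < norm (F y - F t - (y - t) *\<^sub>R G t)}"
  define a where "a = (\<lambda>(t, y). (t + y) / 2 :: real)"
  define r where "r = (\<lambda>(t, y). \<bar>y - t\<bar> / 2 :: real)"
  have ball: "cball (a i) (r i) = I i" for i
  proof (cases i)
    case (Pair t y)
    have "(t + y) / 2 - \<bar>y - t\<bar> / 2 = min t y" "(t + y) / 2 + \<bar>y - t\<bar> / 2 = max t y"
      by (simp_all add: min_def max_def abs_if field_simps)
    then show ?thesis
      by (simp add: Pair a_def r_def I_def cball_eq_atLeastAtMost)
  qed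
  obtain C where C: "countable C" "C \<subseteq> K"
     "pairwise (\<lambda>i j. disjnt (cball (a i) (r i)) (cball (a j) (r j))) C"
     "negligible (?N - (\<Union>i\<in>C. cball (a i) (r i)))"
  proof (rule Vitali_covering_theorem_cballs[of K r ?N a])
    show "0 < r i" if "i \<in> K" for i
      using that by (auto simp: K_def r_def)
    fix t \<delta> :: real assume t: "t \<in> ?N" and "0 < \<delta>"
    obtain \<delta>' where d': "\<delta>' > 0" "ball t \<delta>' \<subseteq> \<gamma> t"
      using \<gamma> unfolding gauge_def by (metis openE)
    \<comment> \<open>The four bounds serve Vitali's radius condition, the gauge, and keeping
      \<open>y\<close> inside \<open>{c..d}\<close> on either side.\<close>
    define \<eta> where "\<eta> = min (min \<delta> \<delta>') (min (t - c) (d - t))"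
    have "\<eta> > 0" using t d' \<open>0 < \<delta>\<close> by (auto simp: \<eta>_def)
    then obtain y where y: "y \<noteq> t" "\<bar>y - t\<bar> < \<eta>" "e * \<bar>y - t\<bar> < norm (F y - F t - (y - t) *\<^sub>R G t)"
      using t by blast
    have le: "\<eta> \<le> \<delta>" "\<eta> \<le> \<delta>'" "\<eta> \<le> t - c" "\<eta> \<le> d - t"
      by (auto simp: \<eta>_def)
    have "I (t, y) \<subseteq> ball t \<delta>'"
      using y(2) le(2) by (auto simp: I_def dist_real_def min_def max_def split: if_splits)
    then have "(t, y) \<in> K"
      using t y le d' unfolding K_def by (auto simp: abs_if split: if_splits)
    moreover have "t \<in> I (t, y)" by (auto simp: I_def)
    moreover have "r (t, y) < \<delta>"
      using y(2) le(1) \<open>0 < \<delta>\<close> by (auto simp: r_def)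
    ultimately show "\<exists>i. i \<in> K \<and> t \<in> cball (a i) (r i) \<and> r i < \<delta>"
      unfolding ball by blast
  qed
  have disj: "I i \<inter> I j = {}" if "i \<in> C" "j \<in> C" "i \<noteq> j" for i j
    using C(3) that unfolding ball pairwise_def disjnt_def by blast
  have fm: "I i \<in> lmeasurable" for i
    by (cases i) (simp add: I_def)
  have bound: "measure lebesgue (\<Union>(I ` J)) \<le> \<epsilon>" if J: "J \<subseteq> C" "finite J" for J
  proof -
    let ?p = "(\<lambda>i. (fst i, I i)) ` J"
    \<comment> \<open>A tag belongs to its own interval and the intervals are disjoint, so equal
      images force equal indices.\<close>
    have inj: "inj_on (\<lambda>i. (fst i, I i)) J"
    proof (rule inj_onI)
      fix i j assume "i \<in> J" "j \<in> J" "(fst i, I i) = (fst j, I j)"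
      moreover have "fst i \<in> I i" by (auto simp: I_def split: prod.splits)
      ultimately show "i = j" using disj[of i j] J by auto
    qed
    have JK: "i \<in> K" if "i \<in> J" for i using that J C(2) by auto
    have "?p tagged_partial_division_of {c..d}"
      unfolding tagged_partial_division_of_def
    proof (intro conjI allI impI)
      fix x k assume "(x, k) \<in> ?p"
      then obtain y where y: "(x, y) \<in> J" "k = I (x, y)" by auto
      with JK[OF y(1)] show "x \<in> k" "k \<subseteq> {c..d}" "\<exists>a b. k = cbox a b"
        by (auto simp: I_def K_def)
    next
      fix x1 K1 x2 K2 assume "(x1, K1) \<in> ?p \<and> (x2, K2) \<in> ?p \<and> (x1, K1) \<noteq> (x2, K2)"
      then obtain i j where "i \<in> J" "j \<in> J" "i \<noteq> j" "K1 = I i" "K2 = I j" by auto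
      then show "interior K1 \<inter> interior K2 = {}"
        using disj[of i j] J interior_subset by blast
    qed (use J in auto)
    moreover have "\<gamma> fine ?p"
    proof (rule fineI, rule subsetI)
      fix x k s assume "(x, k) \<in> (\<lambda>i. (fst i, I i)) ` J" "s \<in> k"
      then obtain y where y: "(x, y) \<in> J" "k = I (x, y)" by auto
      then have "I (x, y) \<subseteq> \<gamma> x" using JK[OF y(1)] by (simp add: K_def)
      then show "s \<in> \<gamma> x" using y \<open>s \<in> k\<close> by blast
    qed
    ultimately have "(\<Sum>(x, k)\<in>?p. norm (Henstock_Kurzweil_Integration.content k *\<^sub>R G x - integral k G)) < e * \<epsilon>"
      by (rule hen)
    also have "(\<Sum>(x, k)\<in>?p. norm (Henstock_Kurzweil_Integration.content k *\<^sub>R G x - integral k G))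
       = (\<Sum>i\<in>J. norm (Henstock_Kurzweil_Integration.content (I i) *\<^sub>R G (fst i) - integral (I i) G))"
      by (subst sum.reindex[OF inj]) simp
    finally have less: "(\<Sum>i\<in>J. norm (Henstock_Kurzweil_Integration.content (I i) *\<^sub>R G (fst i) - integral (I i) G)) < e * \<epsilon>" .
    \<comment> \<open>Each interval errs by more than \<open>e\<close> times its length, while
      Henstock's lemma keeps the total error below \<open>e * \<epsilon>\<close>; dividing by
      \<open>e\<close> bounds the total length.\<close>
    have "e * measure lebesgue (\<Union>(I ` J)) \<le> e * (\<Sum>i\<in>J. measure lebesgue (I i))"
      using \<open>e > 0\<close> J fm by (intro mult_left_mono measure_UNION_le) (auto dest: fmeasurableD)
    also have "\<dots> = (\<Sum>i\<in>J. e * measure lebesgue (I i))"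
      by (rule sum_distrib_left)
    also have "\<dots> \<le> (\<Sum>i\<in>J. norm (Henstock_Kurzweil_Integration.content (I i) *\<^sub>R G (fst i) - integral (I i) G))"
    proof (rule sum_mono)
      fix i assume "i \<in> J"
      then obtain t y where i: "i = (t, y)" "(t, y) \<in> K" using JK by (cases i) auto
      then have "t \<in> {c..d}" "y \<in> {c..d}" "e * \<bar>y - t\<bar> < norm (F y - F t - (y - t) *\<^sub>R G t)"
        by (auto simp: K_def)
      then show "e * measure lebesgue (I i)
          \<le> norm (Henstock_Kurzweil_Integration.content (I i) *\<^sub>R G (fst i) - integral (I i) G)"
        using *[of t y] i by (auto simp: I_def abs_if min_def max_def)
    qed
    finally have "e * measure lebesgue (\<Union>(I ` J)) < e * \<epsilon>" using less by simp
    then show ?thesis using \<open>e > 0\<close> by simp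
  qed
  let ?V = "\<Union>(I ` C)"
  \<comment> \<open>The bound is uniform over finite subfamilies, so it passes to the countable
    union.\<close>
  have V: "?V \<in> lmeasurable" "measure lebesgue ?V \<le> \<epsilon>"
    using fmeasurable_UN_bound[OF C(1), of I lebesgue \<epsilon>] measure_UN_bound[OF C(1), of I lebesgue \<epsilon>] fm bound
    by blast+
  have neg: "negligible (?N - ?V)"
    using C(4) unfolding ball .
  show "\<exists>T. ?N \<subseteq> T \<and> T \<in> lmeasurable \<and> measure lebesgue T \<le> \<epsilon>"
  proof (intro exI[of _ "?V \<union> (?N - ?V)"] conjI)
    show "?V \<union> (?N - ?V) \<in> lmeasurable"
      using fmeasurable.Un[OF V(1) negligible_imp_measurable[OF neg]] .
    have "measure lebesgue (?V \<union> (?N - ?V)) \<le> measure lebesgue ?V + measure lebesgue (?N - ?V)"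
      using measure_Un_le[OF fmeasurableD[OF V(1)] fmeasurableD[OF negligible_imp_measurable[OF neg]]] .
    then show "measure lebesgue (?V \<union> (?N - ?V)) \<le> \<epsilon>"
      using V negligible_imp_measure0[OF neg] by simp
  qed auto
qed

text \<open>If the derivative at \<open>t\<close> is not \<open>G t\<close>, the difference quotient
  errs by more than some \<open>1 / (n + 1)\<close> arbitrarily close to \<open>t\<close>; the
  exceptional set is thus covered by countably many negligible sets.\<close>

theorem negligible_not_has_vector_derivative_indefinite_integral:
  fixes G :: "real \<Rightarrow> 'a::euclidean_space"
  assumes G: "G integrable_on {c..d}"
  shows "negligible {t \<in> {c<..<d}. \<not> ((\<lambda>t. integral {c..t} G) has_vector_derivative G t) (at t)}"
proof -
  define F where "F = (\<lambda>t. integral {c..t} G)"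
  define N where "N e = {t \<in> {c<..<d}. \<forall>\<delta>>0. \<exists>y. y \<noteq> t \<and> \<bar>y - t\<bar> < \<delta> \<and>
            e * \<bar>y - t\<bar> < norm (F y - F t - (y - t) *\<^sub>R G t)}" for e
  have "negligible (\<Union>n. N (1 / real (Suc n)))"
    unfolding N_def F_def
    by (rule negligible_Union_nat) (rule negligible_indefinite_integral_difference_quotient[OF G], simp)
  moreover have "{t \<in> {c<..<d}. \<not> (F has_vector_derivative G t) (at t)} \<subseteq> (\<Union>n. N (1 / real (Suc n)))"
  proof safe
    fix t assume t: "t \<in> {c<..<d}" "\<not> (F has_vector_derivative G t) (at t)"
    show "t \<in> (\<Union>n. N (1 / real (Suc n)))"
    proof (rule ccontr)
      assume no: "t \<notin> (\<Union>n. N (1 / real (Suc n)))"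
      have "(F has_vector_derivative G t) (at t)"
        unfolding has_vector_derivative_def has_derivative_within_alt
      proof (intro conjI allI impI)
        show "bounded_linear (\<lambda>x. x *\<^sub>R G t)" by (rule bounded_linear_scaleR_left)
        fix e :: real assume "e > 0"
        then obtain n where n: "1 / real (Suc n) < e" by (meson nat_approx_posE)
        have "t \<notin> N (1 / real (Suc n))"
          using no by blast
        then have "\<not> (\<forall>\<delta>>0. \<exists>y. y \<noteq> t \<and> \<bar>y - t\<bar> < \<delta> \<and>
            1 / real (Suc n) * \<bar>y - t\<bar> < norm (F y - F t - (y - t) *\<^sub>R G t))"
          using t(1) unfolding N_def by blast
        then obtain \<delta> where \<delta>: "\<delta> > 0"
          "\<And>y. y \<noteq> t \<Longrightarrow> \<bar>y - t\<bar> < \<delta> \<Longrightarrow> norm (F y - F t - (y - t) *\<^sub>R G t) \<le> 1 / real (Suc n) * \<bar>y - t\<bar>"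
          by (meson not_less)
        show "\<exists>d>0. \<forall>y\<in>UNIV. norm (y - t) < d \<longrightarrow> norm (F y - F t - (y - t) *\<^sub>R G t) \<le> e * norm (y - t)"
        proof (intro exI[of _ \<delta>] conjI ballI impI)
          fix y assume "norm (y - t) < \<delta>"
          then show "norm (F y - F t - (y - t) *\<^sub>R G t) \<le> e * norm (y - t)"
            using \<delta>(2)[of y] n mult_right_mono[of "1 / real (Suc n)" e "\<bar>y - t\<bar>"]
            by (cases "y = t") auto
        qed (use \<delta> in auto)
      qed
      with t show False by simp
    qed
  qed
  ultimately show ?thesis
    unfolding F_def by (rule negligible_subset)
qed

text \<open>A direct gauge argument. Tags off the null set are handled by the derivative. Intervals
  with tags in it are confined to an open set so small that absolute continuity bounds the sum of
  their increments. Integrability of \<open>g\<close> comes out as a result, with no measurability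
  assumed beforehand.\<close>

theorem fundamental_theorem_of_calculus_abs_continuous:
  fixes x :: "real \<Rightarrow> 'a::banach"
  assumes "c \<le> d" and ac: "abs_continuous_on {c..d} x" and N: "negligible N"
    and deriv: "\<And>t. t \<in> {c<..<d} - N \<Longrightarrow> (x has_vector_derivative g t) (at t)"
  shows "(g has_integral (x d - x c)) {c..d}"
proof -
  \<comment> \<open>The endpoints are added because \<open>deriv\<close> only speaks of the open
    interval.\<close>
  define M where "M = N \<union> {c, d}"
  have M: "negligible M" using N by (simp add: M_def negligible_insert)
  define h where "h t = (if t \<in> M then 0 else g t)" for t
  have "(h has_integral (x d - x c)) {c..d}"
    unfolding has_integral_real
  proof (intro allI impI)
    fix e :: real assume "e > 0"
    \<comment> \<open>Off \<open>M\<close> the errors are at most \<open>\<eta>\<close> times the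
      length, less than \<open>e / 2\<close> in total; the \<open>+ 1\<close> covers
      \<open>c = d\<close>.\<close>
    define \<eta> where "\<eta> = e / (2 * (d - c + 1))"
    have \<eta>: "\<eta> > 0" "\<eta> * (d - c) < e / 2"
      using \<open>e > 0\<close> \<open>c \<le> d\<close> by (auto simp: \<eta>_def field_simps)
    obtain \<delta> where \<delta>: "\<delta> > 0" and small: "\<And>P. \<lbrakk>nonoverlapping P; \<forall>(a, b)\<in>P. {a..b} \<subseteq> {c..d}; (\<Sum>(a, b)\<in>P. b - a) < \<delta>\<rbrakk>
        \<Longrightarrow> (\<Sum>(a, b)\<in>P. norm (x b - x a)) < e / 2"
      using ac[unfolded abs_continuous_on_iff, rule_format, of "e / 2"] \<open>e > 0\<close> by auto
    obtain U where U: "open U" "M \<subseteq> U" "U \<in> lmeasurable" "measure lebesgue U < \<delta>"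
    proof -
      have "M \<in> sets lebesgue" "emeasure lebesgue M = 0"
        using M by (auto simp: negligible_iff_null_sets)
      then obtain U where U: "open U" "M \<subseteq> U" "U - M \<in> lmeasurable" "emeasure lebesgue (U - M) < ennreal \<delta>"
        using sets_lebesgue_outer_open[of M \<delta>] \<delta> by blast
      have U': "U = (U - M) \<union> M" using U by blast
      have "U \<in> lmeasurable"
        using fmeasurable.Un[OF U(3) negligible_imp_measurable[OF M]] U' by simp
      moreover have "measure lebesgue U \<le> measure lebesgue (U - M) + measure lebesgue M"
        using measure_Un_le[OF fmeasurableD[OF U(3)] fmeasurableD[OF negligible_imp_measurable[OF M]]] U' by simp
      moreover have "measure lebesgue (U - M) < \<delta>"
        using U(3,4) \<delta> by (simp add: emeasure_eq_measure2 ennreal_less_iff)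
      ultimately show ?thesis
        using that[of U] U M by (simp add: negligible_imp_measure0)
    qed
    have "\<exists>r>0. \<forall>y. \<bar>y - t\<bar> < r \<longrightarrow> norm (x y - x t - (y - t) *\<^sub>R g t) \<le> \<eta> * \<bar>y - t\<bar>"
      if "t \<in> {c..d} - M" for t
    proof -
      have "(x has_vector_derivative g t) (at t)"
        using that by (intro deriv) (auto simp: M_def)
      then show ?thesis
        using \<eta> unfolding has_vector_derivative_def has_derivative_within_alt by auto
    qed
    then obtain r where r: "\<And>t. t \<in> {c..d} - M \<Longrightarrow> r t > 0"
      "\<And>t y. \<lbrakk>t \<in> {c..d} - M; \<bar>y - t\<bar> < r t\<rbrakk> \<Longrightarrow> norm (x y - x t - (y - t) *\<^sub>R g t) \<le> \<eta> * \<bar>y - t\<bar>"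
      by metis
    \<comment> \<open>Tags in \<open>M\<close> force their intervals into \<open>U\<close>, whose
      measure is below the \<open>\<delta>\<close> of absolute continuity; other tags stay within
      the range of the derivative estimate.\<close>
    define \<gamma> where "\<gamma> t = (if t \<in> M then U else if t \<in> {c..d} then ball t (r t) else UNIV)" for t
    have "gauge \<gamma>"
      using U r by (intro gaugeI) (auto simp: \<gamma>_def)
    moreover have "norm ((\<Sum>(t, k)\<in>p. Henstock_Kurzweil_Integration.content k *\<^sub>R h t) - (x d - x c)) < e"
      if p: "p tagged_division_of {c..d}" "\<gamma> fine p" for p
    proof -
      have fin: "finite p" using p(1) by blast
      have pk: "\<exists>u v. u \<le> v \<and> k = {u..v} \<and> t \<in> {u..v} \<and> {u..v} \<subseteq> {c..d} \<and> k \<subseteq> \<gamma> t" if tk: "(t, k) \<in> p" for t k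
      proof -
        obtain u v where uv: "k = cbox u v" using tagged_division_ofD(4)[OF p(1) tk] by blast
        have "t \<in> k" "k \<subseteq> {c..d}" using tagged_division_ofD(2,3)[OF p(1) tk] by auto
        moreover have "k \<subseteq> \<gamma> t" using p(2) tk by (auto simp: fine_def)
        ultimately show ?thesis using uv by (intro exI[of _ u] exI[of _ v]) auto
      qed
      \<comment> \<open>Degenerate intervals are dropped, since \<open>nonoverlapping\<close>
        demands \<open>a < b\<close>; content and increment vanish on them anyway.\<close>
      define A where "A = {(t, k) \<in> p. t \<in> M \<and> Inf k < Sup k}"
      define P where "P = (\<lambda>(t, k). (Inf k, Sup k)) ` A"
      have Ap: "A \<subseteq> p" by (auto simp: A_def)
      have Ak: "Inf k < Sup k \<and> k = {Inf k..Sup k} \<and> k \<subseteq> {c..d} \<and> k \<subseteq> U" if "(t, k) \<in> A" for t k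
      proof -
        have "(t, k) \<in> p" "t \<in> M" "Inf k < Sup k" using that by (auto simp: A_def)
        with pk[of t k] show ?thesis by (auto simp: \<gamma>_def)
      qed
      have Adisj: "{Inf k<..<Sup k} \<inter> {Inf k'<..<Sup k'} = {}"
        if "(t, k) \<in> A" "(t', k') \<in> A" "(t, k) \<noteq> (t', k')" for t k t' k'
      proof -
        have "interior k \<inter> interior k' = {}"
          using tagged_division_ofD(5)[OF p(1)] that Ap by blast
        then show ?thesis
          using Ak[OF that(1)] Ak[OF that(2)] by (metis interior_atLeastAtMost_real)
      qed
      have inj: "inj_on (\<lambda>(t, k). (Inf k, Sup k)) A"
      proof (rule inj_onI, clarify)
        fix t k t' k' assume *: "(t, k) \<in> A" "(t', k') \<in> A" "Inf k = Inf k'" "Sup k = Sup k'"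
        show "t = t' \<and> k = k'"
        proof (rule ccontr)
          assume "\<not> (t = t' \<and> k = k')"
          then have "{Inf k<..<Sup k} = {}" using Adisj[OF *(1,2)] * by auto
          then show False using Ak[OF *(1)] by auto
        qed
      qed
      have finA: "finite A" using fin Ap by (rule finite_subset[rotated])
      have P: "nonoverlapping P"
        unfolding nonoverlapping_def pairwise_def
      proof (intro conjI ballI impI)
        show "finite P" using finA by (simp add: P_def)
        show "case q of (a, b) \<Rightarrow> a < b" if "q \<in> P" for q
          using that by (auto simp: P_def dest: Ak)
        fix q q' assume "q \<in> P" "q' \<in> P" "q \<noteq> q'"
        then obtain t k t' k' where *: "(t, k) \<in> A" "(t', k') \<in> A" "q = (Inf k, Sup k)" "q' = (Inf k', Sup k')"
          by (auto simp: P_def)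
        then show "(case q of (a, b) \<Rightarrow> \<lambda>(a', b'). {a<..<b} \<inter> {a'<..<b'} = {}) q'"
          using Adisj[OF *(1,2)] \<open>q \<noteq> q'\<close> by auto
      qed
      have "(\<Sum>(a, b)\<in>P. b - a) = (\<Sum>(t, k)\<in>A. Sup k - Inf k)"
        unfolding P_def by (subst sum.reindex[OF inj]) (simp add: case_prod_unfold)
      also have "\<dots> = (\<Sum>i\<in>A. measure lebesgue {Inf (snd i)<..<Sup (snd i)})"
        by (rule sum.cong) (auto dest: Ak)
      also have "\<dots> = measure lebesgue (\<Union>i\<in>A. {Inf (snd i)<..<Sup (snd i)})"
      proof (rule measure_UNION'[OF finA, symmetric])
        show "pairwise (\<lambda>i j. disjnt {Inf (snd i)<..<Sup (snd i)} {Inf (snd j)<..<Sup (snd j)}) A"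
          unfolding pairwise_def disjnt_def
        proof (intro ballI impI)
          fix i j assume "i \<in> A" "j \<in> A" "i \<noteq> j"
          then show "{Inf (snd i)<..<Sup (snd i)} \<inter> {Inf (snd j)<..<Sup (snd j)} = {}"
            using Adisj[of "fst i" "snd i" "fst j" "snd j"] by (simp add: prod_eq_iff)
        qed
      qed simp
      also have "\<dots> \<le> measure lebesgue U"
      proof (rule measure_mono_fmeasurable)
        show "(\<Union>i\<in>A. {Inf (snd i)<..<Sup (snd i)}) \<subseteq> U"
        proof clarify
          fix t k s assume "(t, k) \<in> A" "s \<in> {Inf (snd (t, k))<..<Sup (snd (t, k))}"
          then have "s \<in> {Inf k..Sup k}" by auto
          then show "s \<in> U" using Ak[OF \<open>(t, k) \<in> A\<close>] by blast
        qed
      qed (use U finA in auto)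
      finally have "(\<Sum>(a, b)\<in>P. b - a) < \<delta>" using U by simp
      moreover have "\<forall>(a, b)\<in>P. {a..b} \<subseteq> {c..d}"
      proof clarify
        fix a b s assume "(a, b) \<in> P" "s \<in> {a..b}"
        then obtain t k where k: "(t, k) \<in> A" "a = Inf k" "b = Sup k" by (auto simp: P_def)
        then show "s \<in> {c..d}" using Ak[OF k(1)] \<open>s \<in> {a..b}\<close> by blast
      qed
      ultimately have "(\<Sum>(a, b)\<in>P. norm (x b - x a)) < e / 2"
        by (intro small P)
      also have "(\<Sum>(a, b)\<in>P. norm (x b - x a)) = (\<Sum>(t, k)\<in>A. norm (x (Sup k) - x (Inf k)))"
        unfolding P_def by (subst sum.reindex[OF inj]) (simp add: case_prod_unfold)
      finally have A_small: "(\<Sum>(t, k)\<in>A. norm (x (Sup k) - x (Inf k))) < e / 2" .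
      have term_bound: "norm (Henstock_Kurzweil_Integration.content k *\<^sub>R h t - (x (Sup k) - x (Inf k)))
          \<le> (if (t, k) \<in> A then norm (x (Sup k) - x (Inf k)) else 0) + \<eta> * Henstock_Kurzweil_Integration.content k"
        if tk: "(t, k) \<in> p" for t k
      proof -
        obtain u v where uv: "u \<le> v" "k = {u..v}" "t \<in> {u..v}" "{u..v} \<subseteq> {c..d}" "k \<subseteq> \<gamma> t"
          using pk[OF tk] by blast
        show ?thesis
        proof (cases "t \<in> M")
          case True
          then show ?thesis
            using uv tk \<eta> by (cases "u = v") (auto simp: A_def h_def norm_minus_commute[of "x u"])
        next
          case False
          then have t: "t \<in> {c..d} - M" using uv by auto
          then have "{u..v} \<subseteq> ball t (r t)" using uv by (auto simp: \<gamma>_def)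
          then have "\<bar>u - t\<bar> < r t" "\<bar>v - t\<bar> < r t"
            using uv(1) by (auto simp: subset_iff dist_real_def abs_minus_commute)
          then have *: "norm (x u - x t - (u - t) *\<^sub>R g t) \<le> \<eta> * \<bar>u - t\<bar>"
            "norm (x v - x t - (v - t) *\<^sub>R g t) \<le> \<eta> * \<bar>v - t\<bar>"
            using r(2)[OF t] by auto
          \<comment> \<open>Straddle lemma: the tag lies between \<open>u\<close> and
            \<open>v\<close>, so the two one-sided errors add up to \<open>\<eta>\<close> times the
            length.\<close>
          have "(v - u) *\<^sub>R g t - (x v - x u)
              = (x u - x t - (u - t) *\<^sub>R g t) - (x v - x t - (v - t) *\<^sub>R g t)"
            by (simp add: algebra_simps)
          also have "norm \<dots> \<le> \<eta> * \<bar>u - t\<bar> + \<eta> * \<bar>v - t\<bar>"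
            by (rule order_trans[OF norm_triangle_ineq4 add_mono[OF *]])
          also have "\<dots> = \<eta> * (v - u)"
            using uv by (simp add: algebra_simps)
          finally show ?thesis
            using False uv by (simp add: h_def A_def)
        qed
      qed
      have "(\<Sum>(t, k)\<in>p. Henstock_Kurzweil_Integration.content k *\<^sub>R h t) - (x d - x c)
          = (\<Sum>(t, k)\<in>p. Henstock_Kurzweil_Integration.content k *\<^sub>R h t - (x (Sup k) - x (Inf k)))"
        using additive_tagged_division_1[OF \<open>c \<le> d\<close> p(1), of x]
        by (simp add: case_prod_unfold sum_subtractf)
      also have "norm \<dots> \<le> (\<Sum>(t, k)\<in>p. (if (t, k) \<in> A then norm (x (Sup k) - x (Inf k)) else 0)
            + \<eta> * Henstock_Kurzweil_Integration.content k)"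
        by (rule sum_norm_le) (use term_bound in auto)
      also have "\<dots> = (\<Sum>(t, k)\<in>p. if (t, k) \<in> A then norm (x (Sup k) - x (Inf k)) else 0)
          + \<eta> * (\<Sum>(t, k)\<in>p. Henstock_Kurzweil_Integration.content k)"
        by (simp add: case_prod_unfold sum.distrib sum_distrib_left)
      also have "(\<Sum>(t, k)\<in>p. if (t, k) \<in> A then norm (x (Sup k) - x (Inf k)) else 0)
          = (\<Sum>(t, k)\<in>A. norm (x (Sup k) - x (Inf k)))"
        using fin Ap by (intro sum.mono_neutral_cong_right) auto
      also have "(\<Sum>(t, k)\<in>p. Henstock_Kurzweil_Integration.content k) = d - c"
        using additive_content_tagged_division[of p c d] p(1) \<open>c \<le> d\<close> by simp
      finally show ?thesis
        using A_small \<eta> by linarith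
    qed
    ultimately show "\<exists>\<gamma>. gauge \<gamma> \<and> (\<forall>\<D>. \<D> tagged_division_of {c..d} \<and> \<gamma> fine \<D> \<longrightarrow>
        norm ((\<Sum>(t, k)\<in>\<D>. Henstock_Kurzweil_Integration.content k *\<^sub>R h t) - (x d - x c)) < e)"
      by (intro exI[of _ \<gamma>] conjI allI impI) auto
  qed
  moreover have "g t = h t" if "t \<in> {c..d} - M" for t
    using that by (simp add: h_def)
  ultimately show ?thesis
    using has_integral_spike[OF M, of "{c..d}" g h] by blast
qed

subsection \<open>Solutions as integral equations\<close>

text \<open>On a bounded interval the constant 1 is integrable, and a number is at most 1 or at most
  its own \<open>p\<close>-th power.\<close>

lemma Lp_loc_absolutely_integrable:
  assumes "m \<in> Lp_loc p" "p \<ge> 1"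
  shows "m absolutely_integrable_on {a..b}"
proof (rule measurable_bounded_by_integrable_imp_absolutely_integrable)
  show "m \<in> borel_measurable (lebesgue_on {a..b})"
    using assms by (auto simp: Lp_loc_def intro: measurable_restrict_space1)
  show "(\<lambda>t. 1 + \<bar>m t\<bar> ^ p) integrable_on {a..b}"
    using assms by (intro integrable_add) (auto simp: Lp_loc_def absolutely_integrable_on_def)
  show "norm (m t) \<le> 1 + \<bar>m t\<bar> ^ p" for t
  proof (cases "\<bar>m t\<bar> \<le> 1")
    case False
    then show ?thesis using self_le_power[of "\<bar>m t\<bar>" p] \<open>p \<ge> 1\<close> by auto
  qed (simp add: add_increasing2)
qed auto

text \<open>Taking absolute values of the two bounds makes them nonnegative at every
  \<open>t\<close>, also on the null set, as the later monotonicity arguments for integrals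
  require.\<close>

lemma LC_bounds:
  assumes "f \<in> LC p" "p \<ge> 1" "compact K"
  obtains m l :: "real \<Rightarrow> real" and N where "negligible N" "\<And>a b. m absolutely_integrable_on {a..b}"
    "\<And>a b. l absolutely_integrable_on {a..b}" "\<And>t. 0 \<le> m t" "\<And>t. 0 \<le> l t"
    "\<And>t z. t \<notin> N \<Longrightarrow> z \<in> K \<Longrightarrow> norm (f (t, z)) \<le> m t"
    "\<And>t z1 z2. t \<notin> N \<Longrightarrow> z1 \<in> K \<Longrightarrow> z2 \<in> K \<Longrightarrow> norm (f (t, z1) - f (t, z2)) \<le> l t * norm (z1 - z2)"
proof -
  obtain m l where ml: "m \<in> Lp_loc p" "l \<in> Lp_loc p" and ae: "AE t in lebesgue.
        (\<forall>z\<in>K. norm (f (t, z)) \<le> m t) \<and>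
        (\<forall>z1\<in>K. \<forall>z2\<in>K. norm (f (t, z1) - f (t, z2)) \<le> l t * norm (z1 - z2))"
    using assms(1,3) unfolding LC_def by blast
  then obtain N where N: "negligible N" "\<And>t. t \<notin> N \<Longrightarrow> (\<forall>z\<in>K. norm (f (t, z)) \<le> m t) \<and>
        (\<forall>z1\<in>K. \<forall>z2\<in>K. norm (f (t, z1) - f (t, z2)) \<le> l t * norm (z1 - z2))"
    unfolding eventually_ae_filter_negligible by blast
  show thesis
  proof (rule that[of N "\<lambda>t. \<bar>m t\<bar>" "\<lambda>t. \<bar>l t\<bar>"])
    show "(\<lambda>t. \<bar>m t\<bar>) absolutely_integrable_on {a..b}" "(\<lambda>t. \<bar>l t\<bar>) absolutely_integrable_on {a..b}" for a b
      using set_integrable_abs[OF Lp_loc_absolutely_integrable[OF ml(1) assms(2)]]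
        set_integrable_abs[OF Lp_loc_absolutely_integrable[OF ml(2) assms(2)]] by auto
    fix t z assume "t \<notin> N" "z \<in> K"
    then show "norm (f (t, z)) \<le> \<bar>m t\<bar>"
      using N(2) by (meson abs_ge_self order_trans)
  next
    fix t z1 z2 assume "t \<notin> N" "z1 \<in> K" "z2 \<in> K"
    then have "norm (f (t, z1) - f (t, z2)) \<le> l t * norm (z1 - z2)" using N(2) by blast
    also have "\<dots> \<le> \<bar>l t\<bar> * norm (z1 - z2)" by (intro mult_right_mono) auto
    finally show "norm (f (t, z1) - f (t, z2)) \<le> \<bar>l t\<bar> * norm (z1 - z2)" .
  qed (use N in auto)
qed

lemma LC_borel_measurable: "f \<in> LC p \<Longrightarrow> f \<in> borel_measurable borel"
  by (simp add: LC_def)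

text \<open>This is where Borel measurability of \<open>f\<close> matters: an outer function that is
  merely Lebesgue measurable need not compose with a Lebesgue measurable path.\<close>

lemma LC_compose_measurable:
  assumes "f \<in> LC p" "u \<in> borel_measurable (lebesgue_on S)" "v \<in> borel_measurable (lebesgue_on S)"
  shows "(\<lambda>s. f (s, u s, v s)) \<in> borel_measurable (lebesgue_on S)"
proof -
  have "(\<lambda>s. s) \<in> borel_measurable (lebesgue_on S)"
    by (intro measurable_restrict_space1 measurable_completion) simp
  then have "(\<lambda>s. (s, u s, v s)) \<in> borel_measurable (lebesgue_on S)"
    using assms by (intro borel_measurable_Pair)
  from measurable_compose[OF this LC_borel_measurable[OF assms(1)]] show ?thesis .
qed

text \<open>The domain \<open>S\<close> is general because continuation needs the half-open interval
  \<open>{0..<\<beta>}\<close>, at whose right end the path is not yet known to have a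
  limit.\<close>

lemma LC_compose_absolutely_integrable:
  assumes f: "f \<in> LC p" "p \<ge> 1" and S: "S \<in> sets lebesgue" "S \<subseteq> {a..b}"
    and uv: "u \<in> borel_measurable (lebesgue_on S)" "v \<in> borel_measurable (lebesgue_on S)"
    and K: "compact K" "\<And>s. s \<in> S \<Longrightarrow> (u s, v s) \<in> K"
  shows "(\<lambda>s. f (s, u s, v s)) absolutely_integrable_on S"
proof -
  obtain m l N where m: "negligible N" "\<And>a b. m absolutely_integrable_on {a..b}"
    "\<And>t z. t \<notin> N \<Longrightarrow> z \<in> K \<Longrightarrow> norm (f (t, z)) \<le> m t"
    using LC_bounds[OF f K(1)] by metis
  let ?g = "\<lambda>s. f (s, u s, v s)"
  show ?thesis
  proof (rule measurable_bounded_by_integrable_imp_absolutely_integrable)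
    show "?g \<in> borel_measurable (lebesgue_on S)"
      by (rule LC_compose_measurable[OF f(1) uv])
    have "m absolutely_integrable_on S"
      using m(2)[of a b] S by (rule set_integrable_subset)
    then have "m integrable_on S" by (simp add: absolutely_integrable_on_def)
    \<comment> \<open>On \<open>N\<close> the majorant is the function itself, so that domination
      holds at every point without affecting integrability.\<close>
    then show "(\<lambda>s. if s \<in> N then norm (?g s) else m s) integrable_on S"
      by (rule integrable_spike[OF _ m(1)]) auto
    show "norm (?g s) \<le> (if s \<in> N then norm (?g s) else m s)" if "s \<in> S" for s
      using m(3) K(2)[OF that] by auto
  qed (use S in auto)
qed

lemma LC_compose_absolutely_integrable_continuous:
  assumes f: "f \<in> LC p" "p \<ge> 1" and uv: "continuous_on {a..b} u" "continuous_on {a..b} v"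
  shows "(\<lambda>s. f (s, u s, v s)) absolutely_integrable_on {a..b}"
proof (rule LC_compose_absolutely_integrable[OF f])
  show "compact ((\<lambda>s. (u s, v s)) ` {a..b})"
    by (intro compact_continuous_image continuous_on_Pair uv compact_Icc)
qed (use uv in \<open>auto intro: continuous_imp_measurable_on_sets_lebesgue\<close>)

lemma continuous_on_delay:
  fixes x :: "real \<Rightarrow> 'a::topological_space"
  assumes "continuous_on {-1..T} x"
  shows "continuous_on {0..T} (\<lambda>s. x (s - 1))" "continuous_on {0..T} x"
proof -
  show "continuous_on {0..T} (\<lambda>s. x (s - 1))"
    by (rule continuous_on_compose2[OF assms]) (auto intro!: continuous_intros)
  show "continuous_on {0..T} x"
    by (rule continuous_on_subset[OF assms]) auto
qed

lemma dde_solution_integral: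
  assumes sol: "dde_solution f \<phi> b x" and f: "f \<in> LC p" "p \<ge> 1" and T: "0 \<le> T" "ereal T < b"
  shows "(\<lambda>s. f (s, x s, x (s - 1))) absolutely_integrable_on {0..T}"
    and "x T = x 0 + integral {0..T} (\<lambda>s. f (s, x s, x (s - 1)))"
proof -
  let ?g = "\<lambda>s. f (s, x s, x (s - 1))"
  have sub: "{-1..T} \<subseteq> sol_interval b"
  proof
    fix t assume "t \<in> {-1..T}"
    then have "-1 \<le> t" "ereal t \<le> ereal T" by auto
    then show "t \<in> sol_interval b"
      using le_less_trans[OF _ T(2)] unfolding sol_interval_def by blast
  qed
  have "continuous_on {-1..T} x"
    using sol sub by (auto simp: dde_solution_def intro: continuous_on_subset)
  note cont = continuous_on_delay[OF this]
  show "?g absolutely_integrable_on {0..T}"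
    by (rule LC_compose_absolutely_integrable_continuous[OF f cont(2,1)])
  have "(?g has_integral (x T - x 0)) {0..T}"
  \<comment> \<open>\<open>dde_solution\<close> grants absolute continuity only for positive
    \<open>T\<close>.\<close>
  proof (cases "T = 0")
    case True
    then show ?thesis by (simp add: has_integral_refl)
  next
    case False
    have "AE t in lebesgue. 0 < t \<and> ereal t < b \<longrightarrow> (x has_vector_derivative ?g t) (at t)"
      using sol by (simp add: dde_solution_def)
    then obtain N where N: "negligible N"
      "{t. \<not> (0 < t \<and> ereal t < b \<longrightarrow> (x has_vector_derivative ?g t) (at t))} \<subseteq> N"
      unfolding eventually_ae_filter_negligible by blast
    show ?thesis
    proof (rule fundamental_theorem_of_calculus_abs_continuous[OF T(1) _ N(1)])
      show "abs_continuous_on {0..T} x"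
        using sol T False by (auto simp: dde_solution_def)
      fix t assume t: "t \<in> {0<..<T} - N"
      then have "ereal t < ereal T" by auto
      then have "ereal t < b" using T(2) by (rule less_trans)
      then show "(x has_vector_derivative ?g t) (at t)" using t N(2) by auto
    qed
  qed
  then have "integral {0..T} ?g = x T - x 0" by (rule integral_unique)
  then show "x T = x 0 + integral {0..T} ?g" by simp
qed

text \<open>Converse of the integral equation: indefinite integrals are absolutely continuous and
  differentiable a.e. It serves to recognise a continued function as a solution.\<close>

lemma dde_solutionI:
  assumes "0 < \<beta>" and \<phi>: "continuous_on {-1..0} \<phi>" "\<And>t. t \<in> {-1..0} \<Longrightarrow> x t = \<phi> t"
    and G: "(\<lambda>s. f (s, x s, x (s - 1))) absolutely_integrable_on {0..\<beta>}"
    and eq: "\<And>t. t \<in> {0..\<beta>} \<Longrightarrow> x t = x 0 + integral {0..t} (\<lambda>s. f (s, x s, x (s - 1)))"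
  shows "dde_solution f \<phi> (ereal \<beta>) x"
  unfolding dde_solution_def
proof (intro conjI ballI allI impI)
  let ?g = "\<lambda>s. f (s, x s, x (s - 1))"
  have gi: "?g integrable_on {0..\<beta>}" using G by (simp add: absolutely_integrable_on_def)
  show "0 < ereal \<beta>" using \<open>0 < \<beta>\<close> by simp
  show "x t = \<phi> t" if "t \<in> {-1..0}" for t using \<phi>(2) that .
  \<comment> \<open>Clamping the time at 0 from both sides glues the history and the integral into
    one continuous formula.\<close>
  have "continuous_on {-1..\<beta>} (\<lambda>t. \<phi> (min t 0) + integral {0..max t 0} ?g)"
    using \<open>0 < \<beta>\<close> by (intro continuous_on_add continuous_on_compose2[OF \<phi>(1)]
        continuous_on_compose2[OF indefinite_integral_continuous_1[OF gi]]) (auto intro!: continuous_intros)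
  moreover have "x t = \<phi> (min t 0) + integral {0..max t 0} ?g" if "t \<in> {-1..\<beta>}" for t
  proof (cases "t \<le> 0")
    case True
    then show ?thesis using that \<phi>(2)[of t] by simp
  next
    case False
    then show ?thesis using that eq[of t] \<phi>(2)[of 0] by simp
  qed
  ultimately have "continuous_on {-1..\<beta>} x"
    by (rule continuous_on_eq[OF _ sym])
  then show "continuous_on (sol_interval (ereal \<beta>)) x"
    by (rule continuous_on_subset) (auto simp: sol_interval_def)
  show "abs_continuous_on {0..T} x" if "0 < T" "ereal T < ereal \<beta>" for T
  proof -
    have "?g absolutely_integrable_on {0..T}"
      using absolutely_integrable_on_subinterval[OF G] that by auto
    from abs_continuous_on_indefinite_integral[OF this, of "x 0"]
    show ?thesis unfolding abs_continuous_on_iff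
    proof (rule all_forward, intro impI)
      fix e :: real
      assume *: "0 < e \<longrightarrow> (\<exists>d>0. \<forall>P. nonoverlapping P \<and> (\<forall>(a, b)\<in>P. {a..b} \<subseteq> {0..T}) \<and> (\<Sum>(a, b)\<in>P. b - a) < d \<longrightarrow>
           (\<Sum>(a, b)\<in>P. norm (x 0 + integral {0..b} ?g - (x 0 + integral {0..a} ?g))) < e)"
        and "0 < e"
      then obtain d where d: "d > 0" "\<And>P. \<lbrakk>nonoverlapping P; \<forall>(a, b)\<in>P. {a..b} \<subseteq> {0..T}; (\<Sum>(a, b)\<in>P. b - a) < d\<rbrakk> \<Longrightarrow>
           (\<Sum>(a, b)\<in>P. norm (x 0 + integral {0..b} ?g - (x 0 + integral {0..a} ?g))) < e"
        by blast
      show "\<exists>d>0. \<forall>P. nonoverlapping P \<and> (\<forall>(a, b)\<in>P. {a..b} \<subseteq> {0..T}) \<and> (\<Sum>(a, b)\<in>P. b - a) < d \<longrightarrow>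
           (\<Sum>(a, b)\<in>P. norm (x b - x a)) < e"
      proof (intro exI[of _ d] conjI allI impI)
        fix P assume P: "nonoverlapping P \<and> (\<forall>(a, b)\<in>P. {a..b} \<subseteq> {0..T}) \<and> (\<Sum>(a, b)\<in>P. b - a) < d"
        have "(\<Sum>(a, b)\<in>P. norm (x b - x a))
            = (\<Sum>(a, b)\<in>P. norm (x 0 + integral {0..b} ?g - (x 0 + integral {0..a} ?g)))"
        proof (rule sum.cong[OF refl], clarify)
          fix a b assume "(a, b) \<in> P"
          then have "a < b" "{a..b} \<subseteq> {0..T}" using P by (auto simp: nonoverlapping_def)
          then have "a \<in> {0..\<beta>}" "b \<in> {0..\<beta>}" using that by auto
          then show "norm (x b - x a) = norm (x 0 + integral {0..b} ?g - (x 0 + integral {0..a} ?g))"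
            using eq[of a] eq[of b] by (simp only:)
        qed
        then show "(\<Sum>(a, b)\<in>P. norm (x b - x a)) < e" using d(2) P by simp
      qed (rule d)
    qed
  qed
  let ?N = "{t \<in> {0<..<\<beta>}. \<not> ((\<lambda>t. integral {0..t} ?g) has_vector_derivative ?g t) (at t)}"
  have N: "negligible ?N"
    by (rule negligible_not_has_vector_derivative_indefinite_integral[OF gi])
  have deriv: "(x has_vector_derivative ?g t) (at t)" if "t \<notin> ?N" "0 < t" "ereal t < ereal \<beta>" for t
  proof -
    have "((\<lambda>t. integral {0..t} ?g) has_vector_derivative ?g t) (at t)" using that by auto
    then have "((\<lambda>t. x 0 + integral {0..t} ?g) has_vector_derivative ?g t) (at t)"
      using has_vector_derivative_add[OF has_vector_derivative_const, of "\<lambda>t. integral {0..t} ?g" "?g t" "at t" "x 0"]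
      by simp
    then show ?thesis
    proof (rule has_vector_derivative_transform_within_open)
      show "open {0<..<\<beta>}" "t \<in> {0<..<\<beta>}" using that by auto
      show "x 0 + integral {0..s} ?g = x s" if "s \<in> {0<..<\<beta>}" for s
        using that by (intro eq[symmetric]) auto
    qed
  qed
  have "{t. \<not> (0 < t \<and> ereal t < ereal \<beta> \<longrightarrow> (x has_vector_derivative ?g t) (at t))} \<subseteq> ?N"
  proof
    fix t assume t: "t \<in> {t. \<not> (0 < t \<and> ereal t < ereal \<beta> \<longrightarrow> (x has_vector_derivative ?g t) (at t))}"
    show "t \<in> ?N"
      by (rule ccontr) (use t deriv[of t] in blast)
  qed
  with N show "AE t in lebesgue. 0 < t \<and> ereal t < ereal \<beta> \<longrightarrow> (x has_vector_derivative ?g t) (at t)"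
    unfolding eventually_ae_filter_negligible by (intro exI[of _ ?N] conjI)
qed

subsection \<open>A Gronwall inequality with delay\<close>

text \<open>The primitive of \<open>l\<close> is only absolutely continuous, so the substitution
  rule goes through the a.e. chain rule. The composite with \<open>exp\<close> stays absolutely
  continuous because \<open>exp\<close> is Lipschitz on the bounded range of the primitive.\<close>

lemma weighted_integral_exp:
  fixes l :: "real \<Rightarrow> real"
  assumes l: "l absolutely_integrable_on {0..\<tau>}" and "t \<in> {0..\<tau>}"
  shows "((\<lambda>s. l s * exp (integral {0..s} l)) has_integral (exp (integral {0..t} l) - 1)) {0..t}"
proof -
  have li: "l integrable_on {0..\<tau>}" using l by (simp add: absolutely_integrable_on_def)
  define \<Lambda> where "\<Lambda> s = integral {0..s} l" for s
  have lt: "l absolutely_integrable_on {0..t}"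
    by (rule absolutely_integrable_on_subinterval[OF l]) (use assms in auto)
  have "continuous_on {0..t} \<Lambda>"
    unfolding \<Lambda>_def by (rule indefinite_integral_continuous_1) (use lt in \<open>simp add: absolutely_integrable_on_def\<close>)
  then have "compact (\<Lambda> ` {0..t})" by (intro compact_continuous_image) auto
  then obtain B where B: "\<And>s. s \<in> {0..t} \<Longrightarrow> \<bar>\<Lambda> s\<bar> \<le> B"
    using compact_imp_bounded bounded_iff by (metis image_eqI real_norm_def)
  have lip: "\<bar>exp (\<Lambda> b) - exp (\<Lambda> a)\<bar> \<le> exp B * \<bar>\<Lambda> b - \<Lambda> a\<bar>" if "a \<in> {0..t}" "b \<in> {0..t}" for a b
  proof -
    have "norm (exp (\<Lambda> b) - exp (\<Lambda> a)) \<le> exp B * norm (\<Lambda> b - \<Lambda> a)"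
    proof (rule field_differentiable_bound[where S = "{-B..B}" and f' = exp])
      show "convex {-B..B}" by simp
      show "(exp has_field_derivative exp z) (at z within {-B..B})" for z
        using DERIV_exp has_field_derivative_at_within by blast
      show "norm (exp z) \<le> exp B" if "z \<in> {-B..B}" for z using that by simp
      show "\<Lambda> b \<in> {-B..B}" "\<Lambda> a \<in> {-B..B}" using B[OF that(1)] B[OF that(2)] by auto
    qed
    then show ?thesis by simp
  qed
  have "((\<lambda>s. l s * exp (\<Lambda> s)) has_integral (exp (\<Lambda> t) - exp (\<Lambda> 0))) {0..t}"
  proof (rule fundamental_theorem_of_calculus_abs_continuous)
    show "0 \<le> t" using assms by simp
    show "abs_continuous_on {0..t} (\<lambda>s. exp (\<Lambda> s))"
      unfolding abs_continuous_on_iff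
    proof (intro allI impI)
      fix e :: real assume "e > 0"
      then have "e / exp B > 0" by simp
      then obtain d where d: "d > 0" "\<And>P. \<lbrakk>nonoverlapping P; \<forall>(a, b)\<in>P. {a..b} \<subseteq> {0..t}; (\<Sum>(a, b)\<in>P. b - a) < d\<rbrakk> \<Longrightarrow>
           (\<Sum>(a, b)\<in>P. norm (\<Lambda> b - \<Lambda> a)) < e / exp B"
        using abs_continuous_on_indefinite_integral[OF lt, of 0, folded \<Lambda>_def, unfolded abs_continuous_on_iff, rule_format, of "e / exp B"]
        by auto
      show "\<exists>d>0. \<forall>P. nonoverlapping P \<and> (\<forall>(a, b)\<in>P. {a..b} \<subseteq> {0..t}) \<and> (\<Sum>(a, b)\<in>P. b - a) < d \<longrightarrow>
           (\<Sum>(a, b)\<in>P. norm (exp (\<Lambda> b) - exp (\<Lambda> a))) < e"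
      proof (intro exI[of _ d] conjI allI impI)
        fix P assume P: "nonoverlapping P \<and> (\<forall>(a, b)\<in>P. {a..b} \<subseteq> {0..t}) \<and> (\<Sum>(a, b)\<in>P. b - a) < d"
        have "(\<Sum>(a, b)\<in>P. norm (exp (\<Lambda> b) - exp (\<Lambda> a))) \<le> (\<Sum>(a, b)\<in>P. exp B * norm (\<Lambda> b - \<Lambda> a))"
        proof (rule sum_mono, clarify)
          fix a b assume "(a, b) \<in> P"
          then have "a < b" "{a..b} \<subseteq> {0..t}" using P by (auto simp: nonoverlapping_def)
          then show "norm (exp (\<Lambda> b) - exp (\<Lambda> a)) \<le> exp B * norm (\<Lambda> b - \<Lambda> a)"
            using lip[of a b] by auto
        qed
        also have "\<dots> = exp B * (\<Sum>(a, b)\<in>P. norm (\<Lambda> b - \<Lambda> a))"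
          by (simp add: sum_distrib_left case_prod_unfold)
        also have "\<dots> < exp B * (e / exp B)"
          using d(2) P by (intro mult_strict_left_mono) auto
        finally show "(\<Sum>(a, b)\<in>P. norm (exp (\<Lambda> b) - exp (\<Lambda> a))) < e" by simp
      qed (rule d)
    qed
    show "negligible {s \<in> {0<..<\<tau>}. \<not> (\<Lambda> has_vector_derivative l s) (at s)}"
      unfolding \<Lambda>_def by (rule negligible_not_has_vector_derivative_indefinite_integral[OF li])
    show "((\<lambda>s. exp (\<Lambda> s)) has_vector_derivative l s * exp (\<Lambda> s)) (at s)"
      if "s \<in> {0<..<t} - {s \<in> {0<..<\<tau>}. \<not> (\<Lambda> has_vector_derivative l s) (at s)}" for s
    proof -
      have "(\<Lambda> has_real_derivative l s) (at s)"
        using that assms by (auto simp: has_real_derivative_iff_has_vector_derivative)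
      then have "((\<lambda>s. exp (\<Lambda> s)) has_real_derivative exp (\<Lambda> s) * l s) (at s)"
        by (auto intro!: derivative_eq_intros)
      then show ?thesis
        by (simp add: has_real_derivative_iff_has_vector_derivative mult.commute)
    qed
  qed
  then show ?thesis by (simp add: \<Lambda>_def)
qed

text \<open>The maximum of \<open>w t * exp (- \<Lambda> t)\<close> is at most \<open>\<delta>\<close>; the delayed term is harmless because
  \<open>\<Lambda>\<close> is nondecreasing.\<close>

lemma delay_gronwall:
  fixes w l :: "real \<Rightarrow> real"
  assumes "0 \<le> \<tau>" and l: "l absolutely_integrable_on {0..\<tau>}" "\<And>t. 0 \<le> l t"
    and w: "continuous_on {-1..\<tau>} w" "\<And>t. t \<in> {-1..0} \<Longrightarrow> w t \<le> \<delta>" and "0 \<le> \<delta>"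
    and ineq: "\<And>t. t \<in> {0..\<tau>} \<Longrightarrow> w t \<le> \<delta> + integral {0..t} (\<lambda>s. l s * (w s + w (s - 1)))"
    and t: "t \<in> {-1..\<tau>}"
  shows "w t \<le> \<delta> * exp (2 * integral {0..\<tau>} l)"
proof -
  \<comment> \<open>The factor 2 pays for the two terms \<open>w s\<close> and
    \<open>w (s - 1)\<close>, which get the same bound \<open>M * exp (\<Lambda> s)\<close>.\<close>
  define k where "k s = 2 * l s" for s
  have k: "k absolutely_integrable_on {0..\<tau>}" "\<And>t. 0 \<le> k t"
    unfolding k_def using l by (auto intro: set_integrable_mult_right)
  have ki: "k integrable_on {0..\<tau>}" using k by (simp add: absolutely_integrable_on_def)
  \<comment> \<open>Extended by 0 to \<open>[-1, 0]\<close>, so that the weight also makes sense at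
    delayed times.\<close>
  define \<Lambda> where "\<Lambda> s = integral {0..max s 0} k" for s
  have mono: "\<Lambda> s \<le> \<Lambda> s'" if "s \<le> s'" "s' \<le> \<tau>" for s s'
    unfolding \<Lambda>_def using that \<open>0 \<le> \<tau>\<close> k(2)
    by (intro integral_subset_le) (auto intro!: integrable_subinterval_real[OF ki])
  have \<Lambda>0: "\<Lambda> s = 0" if "s \<le> 0" for s
    using that by (simp add: \<Lambda>_def max_def)
  have \<Lambda>nn: "0 \<le> \<Lambda> s" if "s \<le> \<tau>" for s
    using mono[of "min s 0" s] \<Lambda>0[of "min s 0"] that by auto
  have "continuous_on {-1..\<tau>} \<Lambda>"
    unfolding \<Lambda>_def using \<open>0 \<le> \<tau>\<close>
    by (intro continuous_on_compose2[OF indefinite_integral_continuous_1[OF ki]]) (auto intro!: continuous_intros)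
  then have "continuous_on {-1..\<tau>} (\<lambda>s. w s * exp (- \<Lambda> s))"
    by (intro continuous_intros w)
  then obtain s0 where s0: "s0 \<in> {-1..\<tau>}" "\<And>s. s \<in> {-1..\<tau>} \<Longrightarrow> w s * exp (- \<Lambda> s) \<le> w s0 * exp (- \<Lambda> s0)"
    using continuous_attains_sup[of "{-1..\<tau>}" "\<lambda>s. w s * exp (- \<Lambda> s)"] \<open>0 \<le> \<tau>\<close> by auto
  define M where "M = w s0 * exp (- \<Lambda> s0)"
  have wM: "w s \<le> M * exp (\<Lambda> s)" if "s \<in> {-1..\<tau>}" for s
    using s0(2)[OF that] mult_right_mono[of "w s * exp (- \<Lambda> s)" M "exp (\<Lambda> s)"]
    by (simp add: M_def exp_minus field_simps)
  have "M \<le> \<delta>"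
  proof (cases "s0 \<le> 0")
    case True
    then show ?thesis using w(2)[of s0] s0(1) by (simp add: M_def \<Lambda>0)
  next
    case False
    show ?thesis
    proof (rule ccontr)
      assume "\<not> M \<le> \<delta>"
      \<comment> \<open>Positivity is what allows \<open>M * exp (\<Lambda> (s - 1))\<close> to be
        replaced by \<open>M * exp (\<Lambda> s)\<close>.\<close>
      then have "M > 0" using \<open>0 \<le> \<delta>\<close> by simp
      have s0': "s0 \<in> {0..\<tau>}" using False s0(1) by auto
      have kE: "((\<lambda>s. k s * exp (integral {0..s} k)) has_integral (exp (integral {0..s0} k) - 1)) {0..s0}"
        by (rule weighted_integral_exp[OF k(1) s0'])
      have "w s0 \<le> \<delta> + integral {0..s0} (\<lambda>s. l s * (w s + w (s - 1)))"
        by (rule ineq[OF s0'])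
      also have "integral {0..s0} (\<lambda>s. l s * (w s + w (s - 1)))
          \<le> integral {0..s0} (\<lambda>s. M * (k s * exp (integral {0..s} k)))"
      proof (rule integral_le)
        show "(\<lambda>s. M * (k s * exp (integral {0..s} k))) integrable_on {0..s0}"
          using kE by (intro integrable_on_mult_right) (auto simp: has_integral_integrable_integral)
        have cont: "continuous_on {0..s0} (\<lambda>s. w s + w (s - 1))"
          using s0' by (intro continuous_on_add continuous_on_compose2[OF w(1)] continuous_on_subset[OF w(1)])
            (auto intro!: continuous_intros)
        have "(\<lambda>s. (w s + w (s - 1)) * l s) absolutely_integrable_on {0..s0}"
        proof (rule absolutely_integrable_bounded_measurable_product_real)
          show "(\<lambda>s. w s + w (s - 1)) \<in> borel_measurable (lebesgue_on {0..s0})"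
            by (rule continuous_imp_measurable_on_sets_lebesgue[OF cont]) simp
          show "bounded ((\<lambda>s. w s + w (s - 1)) ` {0..s0})"
            by (intro compact_imp_bounded compact_continuous_image cont) simp
          show "l absolutely_integrable_on {0..s0}"
            by (rule absolutely_integrable_on_subinterval[OF l(1)]) (use s0' in auto)
        qed simp
        then show "(\<lambda>s. l s * (w s + w (s - 1))) integrable_on {0..s0}"
          by (simp add: absolutely_integrable_on_def mult.commute)
        fix s assume s: "s \<in> {0..s0}"
        have "w s \<le> M * exp (\<Lambda> s)" using s s0' by (intro wM) auto
        moreover have "w (s - 1) \<le> M * exp (\<Lambda> s)"
        proof -
          have "w (s - 1) \<le> M * exp (\<Lambda> (s - 1))" using s s0' by (intro wM) auto
          also have "\<dots> \<le> M * exp (\<Lambda> s)"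
            using mono[of "s - 1" s] s s0' \<open>M > 0\<close> by simp
          finally show ?thesis .
        qed
        ultimately have "w s + w (s - 1) \<le> 2 * (M * exp (\<Lambda> s))" by simp
        then have "l s * (w s + w (s - 1)) \<le> l s * (2 * (M * exp (\<Lambda> s)))"
          using l(2) by (rule mult_left_mono)
        then show "l s * (w s + w (s - 1)) \<le> M * (k s * exp (integral {0..s} k))"
          using s by (simp add: k_def \<Lambda>_def max_absorb1 mult_ac)
      qed
      also have "\<dots> = M * (exp (\<Lambda> s0) - 1)"
        using kE s0' by (simp add: \<Lambda>_def max_absorb1 integral_unique)
      \<comment> \<open>The left side equals \<open>M * exp (\<Lambda> s0)\<close>, so the
        exponentials cancel and leave \<open>M \<le> \<delta>\<close>.\<close>
      finally have "w s0 \<le> \<delta> + M * (exp (\<Lambda> s0) - 1)" by simp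
      moreover have "w s0 = M * exp (\<Lambda> s0)"
        by (simp add: M_def exp_minus)
      ultimately have "M \<le> \<delta>" by (simp add: algebra_simps)
      with \<open>\<not> M \<le> \<delta>\<close> show False by simp
    qed
  qed
  have "w t \<le> M * exp (\<Lambda> t)" by (rule wM[OF t])
  also have "\<dots> \<le> \<delta> * exp (\<Lambda> \<tau>)"
    using \<open>M \<le> \<delta>\<close> \<open>0 \<le> \<delta>\<close> mono[of t \<tau>] t by (intro order_trans[OF mult_right_mono mult_left_mono]) auto
  also have "\<Lambda> \<tau> = 2 * integral {0..\<tau>} l"
    using \<open>0 \<le> \<tau>\<close> by (simp add: \<Lambda>_def k_def[abs_def] Henstock_Kurzweil_Integration.integral_mult_right)
  finally show ?thesis .
qed

subsection \<open>Continuation of bounded solutions\<close>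

text \<open>On a time step shorter than the delay, the delayed argument is a known function
  \<open>\<xi>\<close>, and the equation becomes an ordinary one. Picard iteration solves it;
  projecting the state onto a ball makes the iteration map act on a whole Banach space, and the
  projection is removed afterwards.\<close>

lemma local_existence:
  fixes f :: "'n::finite rhs"
  assumes f: "f \<in> LC p" "p \<ge> 1" and \<xi>: "continuous_on {\<beta>..\<beta> + d} \<xi>" and "0 < d"
  obtains \<eta> u where "0 < \<eta>" "\<eta> \<le> d" "continuous_on {\<beta>..\<beta> + \<eta>} u"
    "\<And>t. t \<in> {\<beta>..\<beta> + \<eta>} \<Longrightarrow> u t = u0 + integral {\<beta>..t} (\<lambda>s. f (s, u s, \<xi> s))"
proof -
  define K where "K = cball u0 1 \<times> \<xi> ` {\<beta>..\<beta> + d}"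
  have "compact K"
    unfolding K_def by (intro compact_Times compact_cball compact_continuous_image \<xi> compact_Icc)
  then obtain m l N where N: "negligible N"
    and m: "\<And>a b. m absolutely_integrable_on {a..b}" "\<And>t. 0 \<le> m t"
      "\<And>t z. t \<notin> N \<Longrightarrow> z \<in> K \<Longrightarrow> norm (f (t, z)) \<le> m t"
    and l: "\<And>a b. l absolutely_integrable_on {a..b}" "\<And>t. 0 \<le> l t"
      "\<And>t z1 z2. t \<notin> N \<Longrightarrow> z1 \<in> K \<Longrightarrow> z2 \<in> K \<Longrightarrow> norm (f (t, z1) - f (t, z2)) \<le> l t * norm (z1 - z2)"
    using LC_bounds[OF f, of K] by metis
  have mi: "m integrable_on {a..b}" and li: "l integrable_on {a..b}" for a b
    using m(1) l(1) by (simp_all add: absolutely_integrable_on_def)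
  \<comment> \<open>The bound 1 on the mass of \<open>m\<close> keeps the solution in the unit ball
    around \<open>u0\<close>; the bound \<open>1 / 2\<close> on the mass of \<open>l\<close> is the
    contraction factor.\<close>
  have "\<exists>\<eta>>0. \<eta> \<le> d \<and> integral {\<beta>..\<beta> + \<eta>} m \<le> 1 \<and> integral {\<beta>..\<beta> + \<eta>} l \<le> 1 / 2"
  proof -
    have small: "\<exists>\<eta>>0. \<forall>t. \<bar>t - \<beta>\<bar> < \<eta> \<and> t \<in> {\<beta>..\<beta> + d} \<longrightarrow> \<bar>integral {\<beta>..t} g\<bar> < 1 / 2"
      if "g integrable_on {\<beta>..\<beta> + d}" for g :: "real \<Rightarrow> real"
      using indefinite_integral_continuous_1[OF that, unfolded continuous_on_iff, rule_format, of \<beta> "1 / 2"] \<open>0 < d\<close>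
      by (auto simp: dist_real_def)
    obtain \<eta>1 \<eta>2 where e: "\<eta>1 > 0" "\<eta>2 > 0"
      "\<And>t. \<bar>t - \<beta>\<bar> < \<eta>1 \<Longrightarrow> t \<in> {\<beta>..\<beta> + d} \<Longrightarrow> \<bar>integral {\<beta>..t} m\<bar> < 1 / 2"
      "\<And>t. \<bar>t - \<beta>\<bar> < \<eta>2 \<Longrightarrow> t \<in> {\<beta>..\<beta> + d} \<Longrightarrow> \<bar>integral {\<beta>..t} l\<bar> < 1 / 2"
      using small[OF mi] small[OF li] by blast
    define \<eta> where "\<eta> = min (min \<eta>1 \<eta>2 / 2) d"
    have "\<eta> > 0" "\<eta> \<le> d" "\<eta> < \<eta>1" "\<eta> < \<eta>2"
      using e \<open>0 < d\<close> by (auto simp: \<eta>_def min_def)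
    then show ?thesis
      using e(3)[of "\<beta> + \<eta>"] e(4)[of "\<beta> + \<eta>"] by (intro exI[of _ \<eta>]) auto
  qed
  then obtain \<eta> where \<eta>: "\<eta> > 0" "\<eta> \<le> d" "integral {\<beta>..\<beta> + \<eta>} m \<le> 1" "integral {\<beta>..\<beta> + \<eta>} l \<le> 1 / 2"
    by blast
  \<comment> \<open>Projection onto a convex set is 1-Lipschitz, so the contraction factor is not
    spoiled.\<close>
  define P where "P = closest_point (cball u0 1)"
  have P: "P v \<in> cball u0 1" "dist (P v) (P v') \<le> dist v v'" "v \<in> cball u0 1 \<Longrightarrow> P v = v" "continuous_on UNIV P" for v v'
    unfolding P_def by (auto intro!: closest_point_in_set closest_point_lipschitz closest_point_self
        continuous_on_closest_point simp del: mem_cball)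
  define H where "H v s = f (s, P (v s), \<xi> s)" for v s
  have KP: "(P v, \<xi> s) \<in> K" if "s \<in> {\<beta>..\<beta> + \<eta>}" for v s
    using P(1) that \<eta> unfolding K_def by auto
  have Hi: "H v absolutely_integrable_on {\<beta>..\<beta> + \<eta>}" if "continuous_on {\<beta>..\<beta> + \<eta>} v" for v
    unfolding H_def
  proof (rule LC_compose_absolutely_integrable_continuous[OF f])
    show "continuous_on {\<beta>..\<beta> + \<eta>} (\<lambda>s. P (v s))"
      by (rule continuous_on_compose2[OF P(4) that]) auto
    show "continuous_on {\<beta>..\<beta> + \<eta>} \<xi>"
      by (rule continuous_on_subset[OF \<xi>]) (use \<eta> in auto)
  qed
  \<comment> \<open>Clamping the time extends the iterates to bounded continuous functions on the
    whole line, the complete space in which the fixed point is sought.\<close>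
  define c where "c t = max \<beta> (min t (\<beta> + \<eta>))" for t
  have c: "c t \<in> {\<beta>..\<beta> + \<eta>}" "t \<in> {\<beta>..\<beta> + \<eta>} \<Longrightarrow> c t = t" for t
    using \<eta> by (auto simp: c_def)
  define \<Gamma> where "\<Gamma> v = Bcontfun (\<lambda>t. u0 + integral {\<beta>..c t} (H (apply_bcontfun v)))" for v
  have cont: "continuous_on S (apply_bcontfun v)" for S and v :: "real \<Rightarrow>\<^sub>C (real ^ 'n)"
    using apply_bcontfun[of v] unfolding bcontfun_def by (auto intro: continuous_on_subset)
  have \<Gamma>: "apply_bcontfun (\<Gamma> v) t = u0 + integral {\<beta>..c t} (H (apply_bcontfun v))" for v t
  proof -
    have *: "continuous_on {\<beta>..\<beta> + \<eta>} (\<lambda>t. u0 + integral {\<beta>..t} (H (apply_bcontfun v)))"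
      using Hi[OF cont] by (intro continuous_intros indefinite_integral_continuous_1)
        (simp add: absolutely_integrable_on_def)
    have "bounded ((\<lambda>t. u0 + integral {\<beta>..t} (H (apply_bcontfun v))) ` {\<beta>..\<beta> + \<eta>})"
      by (intro compact_imp_bounded compact_continuous_image * compact_Icc)
    then have "bounded (range (\<lambda>t. u0 + integral {\<beta>..c t} (H (apply_bcontfun v))))"
      by (rule bounded_subset) (use c in blast)
    moreover have "continuous_on UNIV (\<lambda>t. u0 + integral {\<beta>..c t} (H (apply_bcontfun v)))"
    proof (rule continuous_on_compose2[OF *])
      show "continuous_on UNIV c" unfolding c_def by (intro continuous_intros)
    qed (use c in auto)
    ultimately show ?thesis
      unfolding \<Gamma>_def by (subst Bcontfun_inverse) (auto simp: bcontfun_def)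
  qed
  have "dist (\<Gamma> v) (\<Gamma> v') \<le> 1 / 2 * dist v v'" for v v'
  proof (rule dist_bound)
    fix t
    let ?I = "{\<beta>..c t}"
    have sub: "?I \<subseteq> {\<beta>..\<beta> + \<eta>}" using c(1)[of t] by auto
    have hi: "H (apply_bcontfun w) integrable_on ?I" for w
      using absolutely_integrable_on_subinterval[OF Hi[OF cont] sub] by (simp add: absolutely_integrable_on_def)
    have "dist (apply_bcontfun (\<Gamma> v) t) (apply_bcontfun (\<Gamma> v') t)
        = norm (integral ?I (\<lambda>s. H (apply_bcontfun v) s - H (apply_bcontfun v') s))"
      by (simp add: \<Gamma> dist_norm integral_diff[OF hi hi])
    also have "\<dots> = norm (integral ?I (\<lambda>s. if s \<in> N then 0 else H (apply_bcontfun v) s - H (apply_bcontfun v') s))"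
      by (subst integral_spike[OF N]) auto
    also have "\<dots> \<le> integral ?I (\<lambda>s. l s * dist v v')"
    proof (rule Henstock_Kurzweil_Integration.integral_norm_bound_integral)
      show "(\<lambda>s. if s \<in> N then 0 else H (apply_bcontfun v) s - H (apply_bcontfun v') s) integrable_on ?I"
        using integrable_diff[OF hi hi] N by (rule integrable_spike) auto
      show "(\<lambda>s. l s * dist v v') integrable_on ?I"
        using li by (rule integrable_on_mult_left)
      fix s assume s: "s \<in> ?I"
      have "norm (H (apply_bcontfun v) s - H (apply_bcontfun v') s) \<le> l s * dist v v'" if "s \<notin> N"
      proof -
        have "norm (H (apply_bcontfun v) s - H (apply_bcontfun v') s)
            \<le> l s * norm ((P (apply_bcontfun v s), \<xi> s) - (P (apply_bcontfun v' s), \<xi> s))"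
          unfolding H_def using s sub that by (intro l(3) KP) auto
        also have "norm ((P (apply_bcontfun v s), \<xi> s) - (P (apply_bcontfun v' s), \<xi> s))
            = dist (P (apply_bcontfun v s)) (P (apply_bcontfun v' s))"
          by (simp add: norm_Pair dist_norm)
        also have "\<dots> \<le> dist v v'"
          using P(2) dist_bounded[of v s v'] order_trans by blast
        finally show ?thesis using l(2)[of s] by (simp add: mult_left_mono)
      qed
      then show "norm (if s \<in> N then 0 else H (apply_bcontfun v) s - H (apply_bcontfun v') s) \<le> l s * dist v v'"
        using l(2)[of s] by simp
    qed
    also have "\<dots> = integral ?I l * dist v v'"
      by (rule Henstock_Kurzweil_Integration.integral_mult_left)
    also have "integral ?I l \<le> integral {\<beta>..\<beta> + \<eta>} l"
      using sub l(2) by (intro integral_subset_le li) auto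
    also have "\<dots> \<le> 1 / 2" by (rule \<eta>)
    finally show "dist (apply_bcontfun (\<Gamma> v) t) (apply_bcontfun (\<Gamma> v') t) \<le> 1 / 2 * dist v v'"
      by (simp add: mult_right_mono)
  qed
  then obtain w where w: "\<Gamma> w = w"
    using banach_fix_type[of "1 / 2" \<Gamma>] by auto
  define u where "u = apply_bcontfun w"
  have u: "u t = u0 + integral {\<beta>..t} (H u)" if "t \<in> {\<beta>..\<beta> + \<eta>}" for t
    using \<Gamma>[of w t] w c(2)[OF that] by (simp add: u_def)
  \<comment> \<open>The fixed point never leaves the ball, so the projection acts as the identity
    along it and \<open>u\<close> solves the original equation.\<close>
  have uK: "u t \<in> cball u0 1" if t: "t \<in> {\<beta>..\<beta> + \<eta>}" for t
  proof -
    have sub: "{\<beta>..t} \<subseteq> {\<beta>..\<beta> + \<eta>}" using t by auto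
    have hi: "H u integrable_on {\<beta>..t}"
      using absolutely_integrable_on_subinterval[OF Hi[OF cont] sub, of w] by (simp add: absolutely_integrable_on_def u_def)
    have "dist u0 (u t) = norm (integral {\<beta>..t} (H u))"
      by (simp add: u[OF t] dist_norm)
    also have "\<dots> = norm (integral {\<beta>..t} (\<lambda>s. if s \<in> N then 0 else H u s))"
      by (subst integral_spike[OF N]) auto
    also have "\<dots> \<le> integral {\<beta>..t} m"
    proof (rule Henstock_Kurzweil_Integration.integral_norm_bound_integral[OF _ mi])
      show "(\<lambda>s. if s \<in> N then 0 else H u s) integrable_on {\<beta>..t}"
        using hi N by (rule integrable_spike) auto
      show "norm (if s \<in> N then 0 else H u s) \<le> m s" if "s \<in> {\<beta>..t}" for s
        using m(2)[of s] m(3)[of s] KP[of s "u s"] that sub by (auto simp: H_def)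
    qed
    also have "\<dots> \<le> integral {\<beta>..\<beta> + \<eta>} m"
      using sub m(2) by (intro integral_subset_le mi) auto
    finally show ?thesis using \<eta> by simp
  qed
  show thesis
  proof (rule that[of \<eta> u])
    show "continuous_on {\<beta>..\<beta> + \<eta>} u" unfolding u_def by (rule cont)
    fix t assume t: "t \<in> {\<beta>..\<beta> + \<eta>}"
    have "integral {\<beta>..t} (H u) = integral {\<beta>..t} (\<lambda>s. f (s, u s, \<xi> s))"
      by (rule integral_cong) (use t in \<open>simp add: H_def P(3)[OF uK]\<close>)
    then show "u t = u0 + integral {\<beta>..t} (\<lambda>s. f (s, u s, \<xi> s))" using u[OF t] by simp
  qed (use \<eta> in auto)
qed

text \<open>Along a bounded path \<open>f\<close> is dominated by one integrable function, so the
  integral equation yields a limit at \<open>\<beta>\<close>, from which a local solution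
  starts.\<close>

lemma bounded_dde_solution_extends:
  fixes f :: "'n::finite rhs"
  assumes sol: "dde_solution f \<phi> (ereal \<beta>) x" and f: "f \<in> LC p" "p \<ge> 1"
    and bdd: "bounded (x ` sol_interval (ereal \<beta>))"
  shows "\<exists>b' y. ereal \<beta> < b' \<and> dde_solution f \<phi> b' y \<and> (\<forall>t\<in>sol_interval (ereal \<beta>). y t = x t)"
proof -
  have J: "sol_interval (ereal \<beta>) = {-1..<\<beta>}" by (auto simp: sol_interval_def)
  have "0 < \<beta>" and cont: "continuous_on {-1..<\<beta>} x" and x\<phi>: "\<And>t. t \<in> {-1..0} \<Longrightarrow> x t = \<phi> t"
    using sol by (auto simp: dde_solution_def J)
  obtain R where R: "\<And>t. t \<in> {-1..<\<beta>} \<Longrightarrow> norm (x t) \<le> R"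
    using bdd unfolding J bounded_iff by blast
  define g where "g s = f (s, x s, x (s - 1))" for s
  have "g absolutely_integrable_on {0..<\<beta>}"
    unfolding g_def
  proof (rule LC_compose_absolutely_integrable[OF f])
    show "{0..<\<beta>} \<subseteq> {0..\<beta>}" by auto
    show "x \<in> borel_measurable (lebesgue_on {0..<\<beta>})"
      by (intro continuous_imp_measurable_on_sets_lebesgue continuous_on_subset[OF cont]) auto
    show "(\<lambda>s. x (s - 1)) \<in> borel_measurable (lebesgue_on {0..<\<beta>})"
      by (intro continuous_imp_measurable_on_sets_lebesgue continuous_on_compose2[OF cont])
        (auto intro!: continuous_intros)
    show "compact (cball 0 R \<times> cball 0 R :: ((real ^ 'n) \<times> (real ^ 'n)) set)"
      by (intro compact_Times compact_cball)
    show "(x s, x (s - 1)) \<in> cball 0 R \<times> cball 0 R" if "s \<in> {0..<\<beta>}" for s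
      using R[of s] R[of "s - 1"] that by auto
  qed simp
  moreover have "negligible {s \<in> {0..<\<beta>} - {0..\<beta>}. g s \<noteq> 0}" "negligible {s \<in> {0..\<beta>} - {0..<\<beta>}. g s \<noteq> 0}"
    by (auto intro: negligible_subset[of "{\<beta>}"])
  ultimately have g: "g absolutely_integrable_on {0..\<beta>}"
    using absolutely_integrable_spike_set_eq by blast
  \<comment> \<open>The left limit of \<open>x\<close> at \<open>\<beta>\<close>; the value of
    \<open>x\<close> at \<open>\<beta>\<close> itself is unspecified.\<close>
  define u0 where "u0 = x 0 + integral {0..\<beta>} g"
  \<comment> \<open>The step \<open>1 / 2\<close> is below the delay, so \<open>s - 1\<close> stays
    below \<open>\<beta>\<close>, where \<open>x\<close> is already given.\<close>
  have "continuous_on {\<beta>..\<beta> + 1 / 2} (\<lambda>s. x (s - 1))"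
    by (rule continuous_on_compose2[OF cont]) (use \<open>0 < \<beta>\<close> in \<open>auto intro!: continuous_intros\<close>)
  then obtain \<eta> u where \<eta>: "0 < \<eta>" "\<eta> \<le> 1 / 2" and u: "continuous_on {\<beta>..\<beta> + \<eta>} u"
    "\<And>t. t \<in> {\<beta>..\<beta> + \<eta>} \<Longrightarrow> u t = u0 + integral {\<beta>..t} (\<lambda>s. f (s, u s, x (s - 1)))"
    using local_existence[OF f, where \<xi> = "\<lambda>s. x (s - 1)" and d = "1/2" and \<beta> = \<beta> and ?u0.0 = u0] by auto
  define y where "y t = (if t < \<beta> then x t else u t)" for t
  define h where "h s = f (s, y s, y (s - 1))" for s
  have hg: "h s = g s" if "s < \<beta>" for s
    using that by (simp add: h_def g_def y_def)
  have hu: "h s = f (s, u s, x (s - 1))" if "s \<in> {\<beta>..\<beta> + \<eta>}" for s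
    using that \<eta> by (simp add: h_def y_def)
  have h1: "h absolutely_integrable_on {0..\<beta>}"
    by (rule absolutely_integrable_spike[OF g, of "{\<beta>}"]) (auto simp: hg)
  have "(\<lambda>s. f (s, u s, x (s - 1))) absolutely_integrable_on {\<beta>..\<beta> + \<eta>}"
    by (rule LC_compose_absolutely_integrable_continuous[OF f u(1)], rule continuous_on_compose2[OF cont])
      (use \<open>0 < \<beta>\<close> \<eta> in \<open>auto intro!: continuous_intros\<close>)
  then have h2: "h absolutely_integrable_on {\<beta>..\<beta> + \<eta>}"
    by (rule absolutely_integrable_spike[OF _ negligible_empty]) (simp add: hu)
  have h: "h absolutely_integrable_on {0..\<beta> + \<eta>}"
    using absolutely_integrable_on_combine[OF h1 h2] \<open>0 < \<beta>\<close> \<eta> by simp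
  then have hi: "h integrable_on {0..\<beta> + \<eta>}" by (simp add: absolutely_integrable_on_def)
  have "dde_solution f \<phi> (ereal (\<beta> + \<eta>)) y"
  proof (rule dde_solutionI)
    show "0 < \<beta> + \<eta>" using \<open>0 < \<beta>\<close> \<eta> by simp
    have "continuous_on {-1..0} x" by (rule continuous_on_subset[OF cont]) (use \<open>0 < \<beta>\<close> in auto)
    then show "continuous_on {-1..0} \<phi>"
      by (rule continuous_on_eq) (rule x\<phi>)
    show "y t = \<phi> t" if "t \<in> {-1..0}" for t
      using that x\<phi>[OF that] \<open>0 < \<beta>\<close> by (simp add: y_def)
    show "(\<lambda>s. f (s, y s, y (s - 1))) absolutely_integrable_on {0..\<beta> + \<eta>}"
      using h unfolding h_def .
    fix t assume t: "t \<in> {0..\<beta> + \<eta>}"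
    have y0: "y 0 = x 0" using \<open>0 < \<beta>\<close> by (simp add: y_def)
    have "y t = y 0 + integral {0..t} h"
    proof (cases "t < \<beta>")
      case True
      have "integral {0..t} h = integral {0..t} g"
        by (rule integral_cong) (use True hg in auto)
      then show ?thesis
        using dde_solution_integral(2)[OF sol f, of t] True t by (simp add: y0 g_def[abs_def]) (simp add: y_def)
    next
      case False
      then have t': "t \<in> {\<beta>..\<beta> + \<eta>}" using t by auto
      have "integral {0..t} h = integral {0..\<beta>} h + integral {\<beta>..t} h"
        using integral_diff_subinterval[OF hi, of \<beta> t] t' \<open>0 < \<beta>\<close> by simp
      also have "integral {0..\<beta>} h = integral {0..\<beta>} g"
        by (rule integral_spike[of "{\<beta>}"]) (auto simp: hg)
      also have "integral {\<beta>..t} h = integral {\<beta>..t} (\<lambda>s. f (s, u s, x (s - 1)))"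
        by (rule integral_cong) (use t' hu in auto)
      finally show ?thesis
        using u(2)[OF t'] False by (simp add: y0 u0_def) (simp add: y_def)
    qed
    then show "y t = y 0 + integral {0..t} (\<lambda>s. f (s, y s, y (s - 1)))"
      by (simp add: h_def[abs_def])
  qed
  moreover have "\<forall>t\<in>sol_interval (ereal \<beta>). y t = x t"
    by (simp add: J y_def)
  moreover have "ereal \<beta> < ereal (\<beta> + \<eta>)" using \<eta> by simp
  ultimately show ?thesis by blast
qed

subsection \<open>Convergence of the right-hand sides\<close>

lemma TD_seminorm_pow:
  assumes "p \<ge> 1"
  shows "TD_seminorm p a b z f ^ p = (LINT t:{a..b}|lebesgue. norm (f (t, z)) ^ p)"
proof -
  have "0 \<le> (LINT t:{a..b}|lebesgue. norm (f (t, z)) ^ p)"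
    unfolding set_lebesgue_integral_def by (intro Bochner_Integration.integral_nonneg) auto
  then show ?thesis
    unfolding TD_seminorm_def using assms by (intro real_root_pow_pos2) auto
qed

lemma TD_seminorm_nonneg: "0 \<le> TD_seminorm p a b z f"
proof -
  have "0 \<le> (LINT t:{a..b}|lebesgue. norm (f (t, z)) ^ p)"
    unfolding set_lebesgue_integral_def by (intro Bochner_Integration.integral_nonneg) auto
  then show ?thesis
    unfolding TD_seminorm_def by (cases "p = 0") (auto intro: real_root_ge_zero)
qed

text \<open>The subbase contains the seminorm balls centred at the limit \<open>f\<close> itself,
  and \<open>F\<close> eventually enters each of them.\<close>

lemma limitin_TD_topology_seminorm:
  assumes lim: "limitin (TD_topology p D) F f sequentially" and "p \<ge> 1" "f \<in> LC p"
    and q: "q1 \<in> \<rat>" "q2 \<in> \<rat>" "q1 \<le> q2" and z: "z \<in> D"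
  shows "(\<lambda>n. TD_seminorm p q1 q2 z (\<lambda>u. F n u - f u)) \<longlonglongrightarrow> 0"
proof (rule LIMSEQ_I)
  fix e :: real assume "0 < e"
  let ?U = "{g \<in> LC p. TD_seminorm p q1 q2 z (\<lambda>u. g u - f u) < e}"
  have "openin (TD_topology p D) ?U"
    unfolding TD_topology_def
    by (rule topology_generated_by_Basis) (use assms \<open>0 < e\<close> in blast)
  moreover have "f \<in> ?U"
    using \<open>f \<in> LC p\<close> \<open>0 < e\<close> \<open>p \<ge> 1\<close> by (simp add: TD_seminorm_def power_0_left)
  ultimately have "\<forall>\<^sub>F n in sequentially. F n \<in> ?U"
    using lim unfolding limitin_def by blast
  then obtain n0 where n0: "\<And>n. n \<ge> n0 \<Longrightarrow> F n \<in> ?U"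
    unfolding eventually_sequentially by blast
  have "norm (TD_seminorm p q1 q2 z (\<lambda>u. F n u - f u) - 0) < e" if "n \<ge> n0" for n
    using n0[OF that] TD_seminorm_nonneg[of p q1 q2 z "\<lambda>u. F n u - f u"] by auto
  then show "\<exists>no. \<forall>n\<ge>no. norm (TD_seminorm p q1 q2 z (\<lambda>u. F n u - f u) - 0) < e" by blast
qed

text \<open>Stands in for Hoelder's inequality in the passage from $L^p$ to $L^1$ convergence.\<close>

lemma le_add_power_divide:
  fixes a \<eta> :: real
  assumes "0 \<le> a" "0 < \<eta>" "p \<ge> 1"
  shows "a \<le> \<eta> + a ^ p / \<eta> ^ (p - 1)"
proof (cases "a \<le> \<eta>")
  case True
  then show ?thesis using assms by (simp add: add_increasing2)
next
  case False
  have "a * \<eta> ^ (p - 1) \<le> a * a ^ (p - 1)"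
    using False assms by (intro mult_left_mono power_mono) auto
  also have "\<dots> = a ^ p"
    using \<open>p \<ge> 1\<close> by (simp flip: power_Suc)
  finally have "a \<le> a ^ p / \<eta> ^ (p - 1)"
    using \<open>0 < \<eta>\<close> by (simp add: field_simps)
  then show ?thesis using \<open>0 < \<eta>\<close> by simp
qed

lemma tendsto_integral_norm_of_power:
  fixes h :: "nat \<Rightarrow> real \<Rightarrow> 'a::euclidean_space"
  assumes "p \<ge> 1" "a \<le> b" and h: "\<And>n. h n absolutely_integrable_on {a..b}"
    "\<And>n. (\<lambda>t. norm (h n t) ^ p) integrable_on {a..b}"
    and lim: "(\<lambda>n. integral {a..b} (\<lambda>t. norm (h n t) ^ p)) \<longlonglongrightarrow> 0"
  shows "(\<lambda>n. integral {a..b} (\<lambda>t. norm (h n t))) \<longlonglongrightarrow> 0"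
proof (rule LIMSEQ_I)
  fix e :: real assume "0 < e"
  \<comment> \<open>With \<open>\<eta>\<close> fixed, the first term of
    \<open>le_add_power_divide\<close> integrates to less than \<open>e / 2\<close>, and the second
    tends to 0.\<close>
  define \<eta> where "\<eta> = e / (2 * (b - a + 1))"
  have \<eta>: "\<eta> > 0" "\<eta> * (b - a) < e / 2"
    using \<open>0 < e\<close> \<open>a \<le> b\<close> by (auto simp: \<eta>_def field_simps)
  have "(\<lambda>n. integral {a..b} (\<lambda>t. norm (h n t) ^ p) / \<eta> ^ (p - 1)) \<longlonglongrightarrow> 0"
    using tendsto_divide[OF lim tendsto_const, of "\<eta> ^ (p - 1)"] \<eta> by simp
  then obtain n0 where n0: "\<And>n. n \<ge> n0 \<Longrightarrow> \<bar>integral {a..b} (\<lambda>t. norm (h n t) ^ p) / \<eta> ^ (p - 1)\<bar> < e / 2"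
    using LIMSEQ_D[of _ 0 "e / 2"] \<open>0 < e\<close> by fastforce
  have "norm (integral {a..b} (\<lambda>t. norm (h n t)) - 0) < e" if "n \<ge> n0" for n
  proof -
    have int: "(\<lambda>t. norm (h n t)) integrable_on {a..b}"
      using h(1) by (simp add: absolutely_integrable_on_def)
    have int': "(\<lambda>t. norm (h n t) ^ p / \<eta> ^ (p - 1)) integrable_on {a..b}"
      using h(2) by (rule integrable_on_divide)
    have "integral {a..b} (\<lambda>t. norm (h n t)) \<le> integral {a..b} (\<lambda>t. \<eta> + norm (h n t) ^ p / \<eta> ^ (p - 1))"
      using int int' le_add_power_divide \<eta> \<open>p \<ge> 1\<close> by (intro integral_le integrable_add) auto
    also have "\<dots> = \<eta> * (b - a) + integral {a..b} (\<lambda>t. norm (h n t) ^ p) / \<eta> ^ (p - 1)"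
      using \<open>a \<le> b\<close> by (subst integral_add[OF _ int']) auto
    also have "\<dots> < e"
      using n0[OF that] \<eta> by linarith
    finally have "integral {a..b} (\<lambda>t. norm (h n t)) < e" .
    moreover have "0 \<le> integral {a..b} (\<lambda>t. norm (h n t))"
      using int by (intro Henstock_Kurzweil_Integration.integral_nonneg) auto
    ultimately show ?thesis by simp
  qed
  then show "\<exists>no. \<forall>n\<ge>no. norm (integral {a..b} (\<lambda>t. norm (h n t)) - 0) < e" by blast
qed

section \<open>A measurable substitute for the optimal \<open>l\<close>-bound\<close>

text \<open>The difference quotients are maximised over pairs from a countable dense subset of the
  ball only. This supremum is Borel in \<open>t\<close> and lies below \<open>opt_l_bound\<close>,
  so it inherits the bound \<open>C\<close>; for a.e. \<open>t\<close> continuity of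
  \<open>f\<close> in the state extends its Lipschitz inequality to the whole ball.\<close>

lemma integrable_optimal_l_bound:
  fixes f :: "'n::finite rhs"
  assumes f: "f \<in> LC p" "p \<ge> 1" and "0 < j" "0 \<le> C"
    and bound: "(\<integral>\<^sup>+t\<in>{-r..r}. opt_l_bound f j t \<partial>lebesgue) \<le> ennreal C"
  obtains l N where "l absolutely_integrable_on {-r..r}" "\<And>t. 0 \<le> l t" "integral {-r..r} l \<le> C" "negligible N"
    "\<And>t z1 z2. t \<notin> N \<Longrightarrow> z1 \<in> cball 0 (real j) \<Longrightarrow> z2 \<in> cball 0 (real j) \<Longrightarrow>
        norm (f (t, z1) - f (t, z2)) \<le> l t * norm (z1 - z2)"
proof -
  let ?B = "cball 0 (real j) :: ((real ^ 'n) \<times> (real ^ 'n)) set"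
  \<comment> \<open>The bound from \<open>LC\<close> is used only qualitatively, for finiteness and
    for continuity in the state off \<open>N\<close>; its integral is not controlled by
    \<open>C\<close>.\<close>
  obtain l0 :: "real \<Rightarrow> real" and N where N: "negligible N" and l0: "\<And>t. 0 \<le> l0 t"
    "\<And>t z1 z2. t \<notin> N \<Longrightarrow> z1 \<in> ?B \<Longrightarrow> z2 \<in> ?B \<Longrightarrow> norm (f (t, z1) - f (t, z2)) \<le> l0 t * norm (z1 - z2)"
    using LC_bounds[OF f compact_cball, of 0 "real j"] by metis
  obtain Q where Q: "countable Q" "Q \<subseteq> ?B" "?B \<subseteq> closure Q"
    by (rule separable)
  define PQ where "PQ = {(z1, z2). z1 \<in> Q \<and> z2 \<in> Q \<and> z1 \<noteq> z2}"
  define q where "q t z = norm (f (t, fst z) - f (t, snd z)) / norm (fst z - snd z)" for t z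
  define L where "L t = (SUP z\<in>PQ. ennreal (q t z))" for t
  have "countable PQ"
    by (rule countable_subset[of _ "Q \<times> Q"]) (use Q in \<open>auto simp: PQ_def\<close>)
  have fb: "(\<lambda>t. f (t, z)) \<in> borel_measurable borel" for z
    by (rule measurable_compose[OF _ LC_borel_measurable[OF f(1)]]) simp
  have "(\<lambda>t. ennreal (q t z)) \<in> borel_measurable borel" for z
    unfolding q_def using fb[of "fst z"] fb[of "snd z"] by measurable
  then have "L \<in> borel_measurable borel"
    unfolding L_def using \<open>countable PQ\<close> by (intro borel_measurable_SUP)
  then have Lm: "L \<in> borel_measurable lebesgue"
    by (intro measurable_completion) simp
  have L_le: "L t \<le> opt_l_bound f j t" for t
    unfolding L_def opt_l_bound_def q_def
    by (rule SUP_subset_mono) (use Q in \<open>auto simp: PQ_def\<close>)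
  \<comment> \<open>\<open>enn2real\<close> sends infinity to 0, so \<open>l\<close> never exceeds
    \<open>L\<close>; infinite values can occur only in \<open>N\<close>.\<close>
  define l where "l t = enn2real (L t)" for t
  have lm: "l \<in> borel_measurable lebesgue" unfolding l_def using Lm by measurable
  have Lfin: "L t \<le> ennreal (l0 t)" if "t \<notin> N" for t
    unfolding L_def
  proof (rule SUP_least)
    fix z assume z: "z \<in> PQ"
    then have "norm (f (t, fst z) - f (t, snd z)) \<le> l0 t * norm (fst z - snd z)"
      using Q(2) by (intro l0(2)[OF that]) (auto simp: PQ_def)
    then show "ennreal (q t z) \<le> ennreal (l0 t)"
      using z l0(1)[of t] by (intro ennreal_leI) (auto simp: q_def PQ_def divide_simps)
  qed
  have ennl: "ennreal (l t) \<le> L t" for t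
    by (cases "L t") (auto simp: l_def)
  have Ll: "L t = ennreal (l t)" if "t \<notin> N" for t
    using Lfin[OF that] by (cases "L t") (auto simp: l_def top_unique)
  have fin: "(\<integral>\<^sup>+t. ennreal (indicator {-r..r} t * l t) \<partial>lebesgue) \<le> ennreal C"
  proof -
    \<comment> \<open>Monotonicity of the nonnegative integral holds without measurability of the
      larger integrand.\<close>
    have "(\<integral>\<^sup>+t. ennreal (indicator {-r..r} t * l t) \<partial>lebesgue) \<le> (\<integral>\<^sup>+t\<in>{-r..r}. opt_l_bound f j t \<partial>lebesgue)"
      by (intro nn_integral_mono) (use ennl L_le in \<open>auto split: split_indicator intro: order_trans\<close>)
    then show ?thesis using bound by simp
  qed
  have int: "integrable lebesgue (\<lambda>t. indicator {-r..r} t * l t)"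
  proof (rule integrableI_bounded)
    show "(\<lambda>t. indicator {-r..r} t * l t) \<in> borel_measurable lebesgue"
      by (intro borel_measurable_times borel_measurable_indicator lm) simp
    have "(\<integral>\<^sup>+t. ennreal (norm (indicator {-r..r} t * l t)) \<partial>lebesgue) = (\<integral>\<^sup>+t. ennreal (indicator {-r..r} t * l t) \<partial>lebesgue)"
      by (rule nn_integral_cong) (simp add: l_def)
    also have "\<dots> < \<infinity>" using fin by (rule le_less_trans) simp
    finally show "(\<integral>\<^sup>+t. ennreal (norm (indicator {-r..r} t * l t)) \<partial>lebesgue) < \<infinity>" .
  qed
  show thesis
  proof (rule that[of l N])
    show ai: "l absolutely_integrable_on {-r..r}"
      using int by (simp add: set_integrable_def)
    show "0 \<le> l t" for t by (simp add: l_def)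
    have "integral {-r..r} l = (LINT t|lebesgue. indicator {-r..r} t * l t)"
      using set_lebesgue_integral_eq_integral(2)[OF ai] by (simp add: set_lebesgue_integral_def)
    also have "ennreal \<dots> \<le> ennreal C"
      using nn_integral_eq_integral[OF int] fin by (simp add: l_def)
    finally show "integral {-r..r} l \<le> C"
      using \<open>0 \<le> C\<close> by simp
    show "negligible N" by (rule N)
    fix t z1 z2 assume t: "t \<notin> N" and z: "z1 \<in> ?B" "z2 \<in> ?B"
    have onQ: "norm (f (t, a) - f (t, b)) \<le> l t * norm (a - b)" if "a \<in> Q" "b \<in> Q" for a b
    proof (cases "a = b")
      case False
      then have "ennreal (q t (a, b)) \<le> L t"
        unfolding L_def by (intro SUP_upper) (use that in \<open>auto simp: PQ_def\<close>)
      then have "q t (a, b) \<le> l t"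
        unfolding Ll[OF t] by (simp add: l_def)
      then show ?thesis using False by (simp add: q_def divide_simps)
    qed simp
    have seq: "\<exists>a. (\<forall>n. a n \<in> Q) \<and> a \<longlonglongrightarrow> z \<and> (\<lambda>n. f (t, a n)) \<longlonglongrightarrow> f (t, z)" if zB: "z \<in> ?B" for z
    proof -
      have "\<exists>a. (\<forall>n. a n \<in> Q) \<and> a \<longlonglongrightarrow> z"
        unfolding closure_sequential[symmetric] by (rule subsetD[OF Q(3) zB])
      then obtain a where a: "\<And>n. a n \<in> Q" "a \<longlonglongrightarrow> z" by blast
      have "(\<lambda>n. l0 t * norm (a n - z)) \<longlonglongrightarrow> 0"
        using tendsto_mult_right_zero[OF tendsto_norm_zero[OF LIM_zero[OF a(2)]]] .
      then have "(\<lambda>n. f (t, a n) - f (t, z)) \<longlonglongrightarrow> 0"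
        by (rule Lim_null_comparison[rotated]) (intro always_eventually allI l0(2)[OF t _ zB] subsetD[OF Q(2)] a(1))
      then have "(\<lambda>n. f (t, a n)) \<longlonglongrightarrow> f (t, z)" by (rule LIM_zero_cancel)
      then show ?thesis using a by (intro exI[of _ a]) simp
    qed
    obtain a b where "\<And>n. a n \<in> Q" "a \<longlonglongrightarrow> z1" "(\<lambda>n. f (t, a n)) \<longlonglongrightarrow> f (t, z1)"
      "\<And>n. b n \<in> Q" "b \<longlonglongrightarrow> z2" "(\<lambda>n. f (t, b n)) \<longlonglongrightarrow> f (t, z2)"
      using seq[OF z(1)] seq[OF z(2)] by blast
    then show "norm (f (t, z1) - f (t, z2)) \<le> l t * norm (z1 - z2)"
      using onQ by (intro LIMSEQ_le[where X = "\<lambda>n. norm (f (t, a n) - f (t, b n))" and Y = "\<lambda>n. l t * norm (a n - b n)"]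
          tendsto_intros) auto
  qed
qed

text \<open>The \<open>p\<close>-th power of a sum is at most that of twice the maximum. The
  \<open>Lp_loc\<close> bounds for the compact set \<open>{z}\<close> are taken from
  \<open>LC\<close> directly, because \<open>LC_bounds\<close> retains only their
  integrability.\<close>

lemma LC_section_power_integrable:
  fixes f g :: "'n::finite rhs"
  assumes "f \<in> LC p" "g \<in> LC p" "p \<ge> 1"
  shows "(\<lambda>t. norm (f (t, z) - g (t, z)) ^ p) absolutely_integrable_on {a..b}"
proof -
  have bnd: "\<exists>m N. negligible N \<and> m \<in> Lp_loc p \<and> (\<forall>t. t \<notin> N \<longrightarrow> norm (h (t, z)) \<le> m t)"
    if hLC: "h \<in> LC p" for h :: "'n rhs"
  proof -
    have "compact {z}" by simp
    then obtain m l where m: "m \<in> Lp_loc p" and ae: "AE t in lebesgue.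
        (\<forall>z\<in>{z}. norm (h (t, z)) \<le> m t) \<and>
        (\<forall>z1\<in>{z}. \<forall>z2\<in>{z}. norm (h (t, z1) - h (t, z2)) \<le> l t * norm (z1 - z2))"
      using hLC unfolding LC_def by blast
    then show ?thesis
      unfolding eventually_ae_filter_negligible by blast
  qed
  obtain m1 N1 m2 N2 where m: "negligible N1" "m1 \<in> Lp_loc p" "\<And>t. t \<notin> N1 \<Longrightarrow> norm (f (t, z)) \<le> m1 t"
    "negligible N2" "m2 \<in> Lp_loc p" "\<And>t. t \<notin> N2 \<Longrightarrow> norm (g (t, z)) \<le> m2 t"
    using bnd[OF assms(1)] bnd[OF assms(2)] by blast
  let ?h = "\<lambda>t. norm (f (t, z) - g (t, z)) ^ p"
  let ?M = "\<lambda>t. 2 ^ p * (\<bar>m1 t\<bar> ^ p + \<bar>m2 t\<bar> ^ p)"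
  show ?thesis
  proof (rule measurable_bounded_by_integrable_imp_absolutely_integrable)
    have "(\<lambda>t. f (t, z)) \<in> borel_measurable (lebesgue_on {a..b})" "(\<lambda>t. g (t, z)) \<in> borel_measurable (lebesgue_on {a..b})"
      using LC_compose_measurable[of _ p "\<lambda>_. fst z" "{a..b}" "\<lambda>_. snd z"] assms by simp_all
    then show "?h \<in> borel_measurable (lebesgue_on {a..b})"
      by measurable
    have "?M integrable_on {a..b}"
      using m(2,5) by (intro integrable_on_mult_right integrable_add) (auto simp: Lp_loc_def absolutely_integrable_on_def)
    then show "(\<lambda>t. if t \<in> N1 \<union> N2 then ?h t else ?M t) integrable_on {a..b}"
      using negligible_Un[OF m(1,4)] by (rule integrable_spike) auto
    show "norm (?h t) \<le> (if t \<in> N1 \<union> N2 then ?h t else ?M t)" for t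
    proof (cases "t \<in> N1 \<union> N2")
      case False
      have "norm (f (t, z) - g (t, z)) \<le> norm (f (t, z)) + norm (g (t, z))" by (rule norm_triangle_ineq4)
      also have "\<dots> \<le> 2 * max \<bar>m1 t\<bar> \<bar>m2 t\<bar>" using m(3)[of t] m(6)[of t] False by auto
      finally have "?h t \<le> (2 * max \<bar>m1 t\<bar> \<bar>m2 t\<bar>) ^ p" by (intro power_mono) auto
      also have "\<dots> = 2 ^ p * max \<bar>m1 t\<bar> \<bar>m2 t\<bar> ^ p" by (rule power_mult_distrib)
      also have "\<dots> \<le> ?M t"
        by (intro mult_left_mono) (auto simp: max_def)
      finally show ?thesis using False by simp
    qed simp
  qed simp
qed

lemma tendsto_integral_norm_section:
  fixes f :: "'n::finite rhs"
  assumes lim: "limitin (TD_topology p D) F f sequentially" and "p \<ge> 1" "f \<in> LC p" "\<And>n. F n \<in> LC p"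
    and q: "q1 \<in> \<rat>" "q2 \<in> \<rat>" "q1 \<le> q2" and z: "z \<in> D"
  shows "(\<lambda>n. integral {q1..q2} (\<lambda>t. norm (F n (t, z) - f (t, z)))) \<longlonglongrightarrow> 0"
proof (rule tendsto_integral_norm_of_power[OF \<open>p \<ge> 1\<close> q(3)])
  fix n
  have sec: "(\<lambda>t. h (t, z)) absolutely_integrable_on {q1..q2}" if "h \<in> LC p" for h :: "'n rhs"
    using LC_compose_absolutely_integrable_continuous[OF that \<open>p \<ge> 1\<close>, of q1 q2 "\<lambda>_. fst z" "\<lambda>_. snd z"] by simp
  show "(\<lambda>t. F n (t, z) - f (t, z)) absolutely_integrable_on {q1..q2}"
    using sec assms by (intro set_integral_diff(1)) auto
  show "(\<lambda>t. norm (F n (t, z) - f (t, z)) ^ p) integrable_on {q1..q2}"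
    using LC_section_power_integrable[of "F n" p f] assms by (simp add: absolutely_integrable_on_def)
next
  have "(\<lambda>n. TD_seminorm p q1 q2 z (\<lambda>u. F n u - f u) ^ p) \<longlonglongrightarrow> 0 ^ p"
    by (intro tendsto_power limitin_TD_topology_seminorm[OF lim]) (use assms in auto)
  also have "(\<lambda>n. TD_seminorm p q1 q2 z (\<lambda>u. F n u - f u) ^ p)
      = (\<lambda>n. integral {q1..q2} (\<lambda>t. norm (F n (t, z) - f (t, z)) ^ p))"
    using TD_seminorm_pow[OF \<open>p \<ge> 1\<close>, of q1 q2 z] assms
    by (simp add: set_lebesgue_integral_eq_integral(2)[OF LC_section_power_integrable])
  finally show "(\<lambda>n. integral {q1..q2} (\<lambda>t. norm (F n (t, z) - f (t, z)) ^ p)) \<longlonglongrightarrow> 0"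
    using \<open>p \<ge> 1\<close> by (simp add: power_0_left)
qed

section \<open>Lipschitz control in the integral sense and convergence along a path\<close>

text \<open>The kernel and the null set are hidden behind the existential because they vary with
  \<open>f\<close>; uniformity over a family is expressed by a common \<open>C\<close>.\<close>

definition integrally_lipschitz :: "'n::finite rhs \<Rightarrow> real \<Rightarrow> real \<Rightarrow> real \<Rightarrow> bool" where
  "integrally_lipschitz f T R C \<longleftrightarrow> (\<exists>l N. l absolutely_integrable_on {0..T} \<and> (\<forall>t. 0 \<le> l t) \<and>
     integral {0..T} l \<le> C \<and> negligible N \<and>
     (\<forall>t z1 z2. t \<notin> N \<longrightarrow> z1 \<in> cball 0 R \<longrightarrow> z2 \<in> cball 0 R \<longrightarrow>
        norm (f (t, z1) - f (t, z2)) \<le> l t * norm (z1 - z2)))"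

lemma integrally_lipschitzE:
  assumes "integrally_lipschitz f T R C"
  obtains l N where "l absolutely_integrable_on {0..T}" "\<And>t. 0 \<le> l t" "integral {0..T} l \<le> C" "negligible N"
    "\<And>t z1 z2. t \<notin> N \<Longrightarrow> z1 \<in> cball 0 R \<Longrightarrow> z2 \<in> cball 0 R \<Longrightarrow>
        norm (f (t, z1) - f (t, z2)) \<le> l t * norm (z1 - z2)"
  using assms unfolding integrally_lipschitz_def by metis

lemma LC_integrally_lipschitz:
  assumes "f \<in> LC p" "p \<ge> 1"
  obtains C where "integrally_lipschitz f T R C"
proof -
  obtain l N where "negligible N" "\<And>a b. l absolutely_integrable_on {a..b}" "\<And>t. 0 \<le> l t"
    "\<And>t z1 z2. t \<notin> N \<Longrightarrow> z1 \<in> cball 0 R \<Longrightarrow> z2 \<in> cball 0 R \<Longrightarrow>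
        norm (f (t, z1) - f (t, z2)) \<le> l t * norm (z1 - z2)"
    using LC_bounds[OF assms compact_cball, of 0 R] by metis
  then have "integrally_lipschitz f T R (integral {0..T} l)"
    unfolding integrally_lipschitz_def by (intro exI[of _ l] exI[of _ N]) auto
  then show thesis by (rule that)
qed

text \<open>The approximation of the path by points of \<open>D\<close> is uniform in time, so its
  error is \<open>\<epsilon>\<close> times the mass of the two kernels and bounded masses
  suffice.\<close>

lemma tendsto_integral_along_path:
  fixes f :: "'n::finite rhs" and u v :: "real \<Rightarrow> real ^ 'n"
  assumes sec: "\<And>z. z \<in> D \<Longrightarrow> (\<lambda>n. integral {0..T} (\<lambda>t. norm (F n (t, z) - f (t, z)))) \<longlonglongrightarrow> 0"
    and f: "f \<in> LC p" and F: "\<And>n. F n \<in> LC p" and "p \<ge> 1" "closure D = UNIV" "0 \<le> T"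
    and uv: "continuous_on {0..T} u" "continuous_on {0..T} v"
    and lip: "\<And>R. \<exists>C. \<forall>n. integrally_lipschitz (F n) T R C"
  shows "(\<lambda>n. integral {0..T} (\<lambda>s. norm (F n (s, u s, v s) - f (s, u s, v s)))) \<longlonglongrightarrow> 0"
proof (rule LIMSEQ_I)
  fix e :: real assume "0 < e"
  define Z where "Z = (\<lambda>s. (u s, v s)) ` {0..T}"
  have "compact Z"
    unfolding Z_def by (intro compact_continuous_image continuous_on_Pair uv compact_Icc)
  then obtain R where R: "\<And>z. z \<in> Z \<Longrightarrow> norm z \<le> R"
    using compact_imp_bounded bounded_iff by metis
  obtain C1 where C1: "\<And>n. integrally_lipschitz (F n) T (R + 1) C1" using lip by blast
  obtain C2 where C2: "integrally_lipschitz f T (R + 1) C2"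
    using LC_integrally_lipschitz[OF f \<open>p \<ge> 1\<close>] by blast
  obtain l2 N2 where l2: "l2 absolutely_integrable_on {0..T}" "\<And>t. 0 \<le> l2 t" "integral {0..T} l2 \<le> C2" "negligible N2"
    "\<And>t z1 z2. t \<notin> N2 \<Longrightarrow> z1 \<in> cball 0 (R + 1) \<Longrightarrow> z2 \<in> cball 0 (R + 1) \<Longrightarrow>
        norm (f (t, z1) - f (t, z2)) \<le> l2 t * norm (z1 - z2)"
    by (rule integrally_lipschitzE[OF C2]) blast
  define c where "c = \<bar>C1\<bar> + \<bar>C2\<bar> + 1"
  \<comment> \<open>\<open>c\<close> exceeds the mass of both kernels together and is positive; the
    cap 1 keeps the centres used within radius \<open>R + 1\<close>.\<close>
  define \<epsilon> where "\<epsilon> = min 1 (e / (2 * c))"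
  have "c > 0" by (simp add: c_def)
  have \<epsilon>: "\<epsilon> > 0" "\<epsilon> \<le> 1" "\<epsilon> * c \<le> e / 2"
  proof -
    show "\<epsilon> > 0" "\<epsilon> \<le> 1" using \<open>0 < e\<close> \<open>c > 0\<close> by (auto simp: \<epsilon>_def)
    have "\<epsilon> * c \<le> e / (2 * c) * c" using \<open>c > 0\<close> by (intro mult_right_mono) (auto simp: \<epsilon>_def)
    then show "\<epsilon> * c \<le> e / 2" using \<open>c > 0\<close> by simp
  qed
  have "Z \<subseteq> (\<Union>d\<in>D. ball d \<epsilon>)"
  proof
    fix z
    have "z \<in> closure D" using \<open>closure D = UNIV\<close> by simp
    then show "z \<in> (\<Union>d\<in>D. ball d \<epsilon>)"
      using \<epsilon>(1) unfolding closure_approachable by auto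
  qed
  then obtain D' where D': "D' \<subseteq> D" "finite D'" "Z \<subseteq> (\<Union>d\<in>D'. ball d \<epsilon>)"
    using compactE_image[OF \<open>compact Z\<close>, of D "\<lambda>d. ball d \<epsilon>"] by auto
  have seci: "(\<lambda>t. norm (F n (t, d) - f (t, d))) integrable_on {0..T}" for n d
  proof -
    have "(\<lambda>t. h (t, d)) absolutely_integrable_on {0..T}" if "h \<in> LC p" for h :: "'n rhs"
      using LC_compose_absolutely_integrable_continuous[OF that \<open>p \<ge> 1\<close>, of 0 T "\<lambda>_. fst d" "\<lambda>_. snd d"] by simp
    then have "(\<lambda>t. F n (t, d) - f (t, d)) absolutely_integrable_on {0..T}"
      using F f by (intro set_integral_diff(1)) auto
    then show ?thesis by (simp add: absolutely_integrable_on_def)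
  qed
  have pathi: "(\<lambda>s. norm (F n (s, u s, v s) - f (s, u s, v s))) integrable_on {0..T}" for n
  proof -
    have "(\<lambda>s. F n (s, u s, v s) - f (s, u s, v s)) absolutely_integrable_on {0..T}"
      by (intro set_integral_diff(1) LC_compose_absolutely_integrable_continuous[OF _ \<open>p \<ge> 1\<close>] F f uv)
    then show ?thesis by (simp add: absolutely_integrable_on_def)
  qed
  have bound: "integral {0..T} (\<lambda>s. norm (F n (s, u s, v s) - f (s, u s, v s)))
      \<le> e / 2 + (\<Sum>d\<in>D'. integral {0..T} (\<lambda>t. norm (F n (t, d) - f (t, d))))" for n
  proof -
    obtain l1 N1 where l1: "l1 absolutely_integrable_on {0..T}" "\<And>t. 0 \<le> l1 t" "integral {0..T} l1 \<le> C1" "negligible N1"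
      "\<And>t z1 z2. t \<notin> N1 \<Longrightarrow> z1 \<in> cball 0 (R + 1) \<Longrightarrow> z2 \<in> cball 0 (R + 1) \<Longrightarrow>
          norm (F n (t, z1) - F n (t, z2)) \<le> l1 t * norm (z1 - z2)"
      by (rule integrally_lipschitzE[OF C1]) blast
    have li: "l1 integrable_on {0..T}" "l2 integrable_on {0..T}"
      using l1(1) l2(1) by (simp_all add: absolutely_integrable_on_def)
    let ?h = "\<lambda>s. norm (F n (s, u s, v s) - f (s, u s, v s))"
    \<comment> \<open>The point of \<open>D'\<close> near the path changes with \<open>s\<close>.
      Summing over all of \<open>D'\<close> covers every choice and avoids selecting it
      measurably.\<close>
    let ?S = "\<lambda>s. \<Sum>d\<in>D'. norm (F n (s, d) - f (s, d))"
    let ?N = "N1 \<union> N2"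
    have N: "negligible ?N" using l1(4) l2(4) by (rule negligible_Un)
    have Si: "?S integrable_on {0..T}" by (intro integrable_sum D' seci)
    have "integral {0..T} ?h = integral {0..T} (\<lambda>s. if s \<in> ?N then 0 else ?h s)"
      by (rule integral_spike[OF N]) auto
    also have "\<dots> \<le> integral {0..T} (\<lambda>s. \<epsilon> * (l1 s + l2 s) + ?S s)"
    proof (rule integral_le)
      show "(\<lambda>s. if s \<in> ?N then 0 else ?h s) integrable_on {0..T}"
        using pathi N by (rule integrable_spike) auto
      show "(\<lambda>s. \<epsilon> * (l1 s + l2 s) + ?S s) integrable_on {0..T}"
        by (intro integrable_add Si integrable_on_mult_right li)
      fix s assume s: "s \<in> {0..T}"
      have nn1: "0 \<le> \<epsilon> * (l1 s + l2 s)" using \<epsilon>(1) l1(2)[of s] l2(2)[of s] by simp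
      have nn2: "0 \<le> ?S s" by (intro sum_nonneg) auto
      have hle: "?h s \<le> \<epsilon> * (l1 s + l2 s) + ?S s" if sN: "s \<notin> ?N"
      proof -
        define z where "z = (u s, v s)"
        have zZ: "z \<in> Z" using s by (auto simp: z_def Z_def)
        then obtain d where d: "d \<in> D'" "dist d z < \<epsilon>" using D'(3) by auto
        have zd: "z \<in> cball 0 (R + 1)" "d \<in> cball 0 (R + 1)"
        proof -
          have "norm d \<le> norm z + dist d z"
            using norm_triangle_sub[of d z] by (simp add: dist_norm)
          then show "z \<in> cball 0 (R + 1)" "d \<in> cball 0 (R + 1)" using R[OF zZ] d \<epsilon>(2) by auto
        qed
        have "?h s = norm ((F n (s, z) - F n (s, d)) - (f (s, z) - f (s, d)) + (F n (s, d) - f (s, d)))"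
          by (simp add: z_def)
        also have "\<dots> \<le> norm (F n (s, z) - F n (s, d)) + norm (f (s, z) - f (s, d)) + norm (F n (s, d) - f (s, d))"
          by (intro norm_triangle_le add_right_mono norm_triangle_ineq4)
        also have "norm (F n (s, z) - F n (s, d)) \<le> l1 s * norm (z - d)"
          using sN zd by (intro l1(5)) auto
        also have "norm (f (s, z) - f (s, d)) \<le> l2 s * norm (z - d)"
          using sN zd by (intro l2(5)) auto
        also have "l1 s * norm (z - d) + l2 s * norm (z - d) = (l1 s + l2 s) * dist d z"
          by (simp add: dist_norm norm_minus_commute algebra_simps)
        also have "\<dots> \<le> (l1 s + l2 s) * \<epsilon>"
          using d(2) l1(2)[of s] l2(2)[of s] by (intro mult_left_mono) auto
        also have "norm (F n (s, d) - f (s, d)) \<le> ?S s"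
          using d(1) D'(2) by (intro member_le_sum) auto
        finally show ?thesis by (simp add: mult.commute)
      qed
      show "(if s \<in> ?N then 0 else ?h s) \<le> \<epsilon> * (l1 s + l2 s) + ?S s"
      proof (cases "s \<in> ?N")
        case True
        then show ?thesis using add_nonneg_nonneg[OF nn1 nn2] by (simp only: if_True)
      next
        case False
        show ?thesis unfolding if_not_P[OF False] by (rule hle[OF False])
      qed
    qed
    also have "\<dots> = \<epsilon> * (integral {0..T} l1 + integral {0..T} l2)
        + (\<Sum>d\<in>D'. integral {0..T} (\<lambda>t. norm (F n (t, d) - f (t, d))))"
      by (subst integral_add) (auto intro!: Si integrable_on_mult_right integrable_add li
          simp: Henstock_Kurzweil_Integration.integral_mult_right integral_add[OF li] integral_sum[OF D'(2) seci])
    also have "\<epsilon> * (integral {0..T} l1 + integral {0..T} l2) \<le> \<epsilon> * c"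
      using \<epsilon>(1) l1(3) l2(3) by (intro mult_left_mono) (auto simp: c_def)
    also have "\<dots> \<le> e / 2" by (rule \<epsilon>)
    finally show ?thesis by simp
  qed
  have "(\<lambda>n. \<Sum>d\<in>D'. integral {0..T} (\<lambda>t. norm (F n (t, d) - f (t, d)))) \<longlonglongrightarrow> (\<Sum>d\<in>D'. 0)"
    using D'(1) by (intro tendsto_sum sec) auto
  then have "(\<lambda>n. \<Sum>d\<in>D'. integral {0..T} (\<lambda>t. norm (F n (t, d) - f (t, d)))) \<longlonglongrightarrow> 0" by simp
  from LIMSEQ_D[OF this, of "e / 2"] obtain n0 where n0: "\<And>n. n \<ge> n0 \<Longrightarrow>
      norm ((\<Sum>d\<in>D'. integral {0..T} (\<lambda>t. norm (F n (t, d) - f (t, d)))) - 0) < e / 2"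
    using \<open>0 < e\<close> by auto
  have "norm (integral {0..T} (\<lambda>s. norm (F n (s, u s, v s) - f (s, u s, v s))) - 0) < e" if "n \<ge> n0" for n
  proof -
    have "0 \<le> integral {0..T} (\<lambda>s. norm (F n (s, u s, v s) - f (s, u s, v s)))"
      by (intro Henstock_Kurzweil_Integration.integral_nonneg pathi) auto
    then show ?thesis using bound[of n] n0[OF that] by auto
  qed
  then show "\<exists>no. \<forall>n\<ge>no. norm (integral {0..T} (\<lambda>s. norm (F n (s, u s, v s) - f (s, u s, v s))) - 0) < e"
    by blast
qed

subsection \<open>Continuous dependence\<close>

lemma dde_solution_continuous_on:
  assumes "dde_solution f \<phi> b x" "ereal T < b"
  shows "continuous_on {-1..T} x"
proof -
  have "{-1..T} \<subseteq> sol_interval b"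
    using assms(2) by (auto simp: sol_interval_def intro: le_less_trans[of _ "ereal T"])
  then show ?thesis
    using assms(1) by (auto simp: dde_solution_def intro: continuous_on_subset)
qed

text \<open>The initial error and the error of the right-hand sides along \<open>x\<close>
  contribute \<open>\<eta>\<close> each, hence the factor 2 in front; the 2 in the exponent comes
  from the delayed term in \<open>delay_gronwall\<close>. The localisation in the ball is required
  strictly before \<open>\<tau>\<close>, to suit a first exit time.\<close>

lemma dde_solution_distance:
  fixes f g :: "'n::finite rhs"
  assumes x: "dde_solution f \<phi> b x" "f \<in> LC p" "ereal T < b"
    and y: "dde_solution g \<psi> b' y" "g \<in> LC p" "ereal \<tau> < b'"
    and "p \<ge> 1" and \<tau>: "0 \<le> \<tau>" "\<tau> \<le> T"
    and lip: "integrally_lipschitz g T R C"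
    and init: "\<And>t. t \<in> {-1..0} \<Longrightarrow> norm (\<psi> t - \<phi> t) \<le> \<eta>"
    and path: "integral {0..T} (\<lambda>s. norm (g (s, x s, x (s - 1)) - f (s, x s, x (s - 1)))) \<le> \<eta>"
    and R: "\<And>s. 0 \<le> s \<Longrightarrow> s < \<tau> \<Longrightarrow> (x s, x (s - 1)) \<in> cball 0 R"
      "\<And>s. 0 \<le> s \<Longrightarrow> s < \<tau> \<Longrightarrow> (y s, y (s - 1)) \<in> cball 0 R"
    and t: "t \<in> {-1..\<tau>}"
  shows "norm (y t - x t) \<le> 2 * \<eta> * exp (2 * C)"
proof -
  have "0 \<le> \<eta>" using order_trans[OF norm_ge_zero init[of 0]] by simp
  have x0: "x t = \<phi> t" and y0: "y t = \<psi> t" if "t \<in> {-1..0}" for t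
    using x(1) y(1) that by (auto simp: dde_solution_def)
  have xT: "ereal t < b" if "t \<le> T" for t
    using le_less_trans[OF _ x(3), of "ereal t"] that by simp
  have yT: "ereal t < b'" if "t \<le> \<tau>" for t
    using le_less_trans[OF _ y(3), of "ereal t"] that by simp
  have xc: "continuous_on {-1..\<tau>} x" and yc: "continuous_on {-1..\<tau>} y"
    using dde_solution_continuous_on[OF x(1) xT] dde_solution_continuous_on[OF y(1) yT] \<tau> by auto
  have xcT: "continuous_on {-1..T} x"
    using dde_solution_continuous_on[OF x(1,3)] .
  obtain l N where l: "l absolutely_integrable_on {0..T}" "\<And>t. 0 \<le> l t" "integral {0..T} l \<le> C" and N: "negligible N"
    and lipN: "\<And>t z1 z2. t \<notin> N \<Longrightarrow> z1 \<in> cball 0 R \<Longrightarrow> z2 \<in> cball 0 R \<Longrightarrow>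
        norm (g (t, z1) - g (t, z2)) \<le> l t * norm (z1 - z2)"
    by (rule integrally_lipschitzE[OF lip]) blast
  define w where "w t = norm (y t - x t)" for t
  have wc: "continuous_on {-1..\<tau>} w"
    unfolding w_def by (intro continuous_intros xc yc)
  have l\<tau>: "l absolutely_integrable_on {0..\<tau>}"
    by (rule absolutely_integrable_on_subinterval[OF l(1)]) (use \<tau> in auto)
  have "w t \<le> 2 * \<eta> * exp (2 * integral {0..\<tau>} l)"
  proof (rule delay_gronwall[OF \<tau>(1) l\<tau> l(2) wc _ _ _ t])
    show "0 \<le> 2 * \<eta>" using \<open>0 \<le> \<eta>\<close> by simp
    show "w t \<le> 2 * \<eta>" if "t \<in> {-1..0}" for t
      using init[OF that] x0[OF that] y0[OF that] \<open>0 \<le> \<eta>\<close> by (simp add: w_def)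
    fix t assume t: "t \<in> {0..\<tau>}"
    let ?fx = "\<lambda>s. f (s, x s, x (s - 1))" and ?gx = "\<lambda>s. g (s, x s, x (s - 1))" and ?gy = "\<lambda>s. g (s, y s, y (s - 1))"
    have xct: "continuous_on {-1..t} x"
      by (rule continuous_on_subset[OF xc]) (use t in auto)
    have gxT: "?gx absolutely_integrable_on {0..T}" and fxT: "?fx absolutely_integrable_on {0..T}"
      using LC_compose_absolutely_integrable_continuous[OF _ \<open>p \<ge> 1\<close> continuous_on_delay(2,1)[OF xcT]] x(2) y(2) by auto
    have sub: "{0..t} \<subseteq> {0..T}" using t \<tau> by auto
    have fx: "?fx integrable_on {0..t}" "x t = x 0 + integral {0..t} ?fx"
      using dde_solution_integral[OF x(1,2) \<open>p \<ge> 1\<close>, of t] t \<tau> xT by (auto simp: absolutely_integrable_on_def)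
    have gy: "?gy integrable_on {0..t}" "y t = y 0 + integral {0..t} ?gy"
      using dde_solution_integral[OF y(1,2) \<open>p \<ge> 1\<close>, of t] t yT by (auto simp: absolutely_integrable_on_def)
    have gx: "?gx integrable_on {0..t}"
      using absolutely_integrable_on_subinterval[OF gxT sub] by (simp add: absolutely_integrable_on_def)
    have dT: "(\<lambda>s. norm (?gx s - ?fx s)) integrable_on {0..T}"
      using set_integral_diff(1)[OF gxT fxT] by (simp add: absolutely_integrable_on_def)
    have d: "(\<lambda>s. norm (?gx s - ?fx s)) integrable_on {0..t}"
      using dT sub by (rule integrable_subinterval_real)
    have lw: "(\<lambda>s. l s * (w s + w (s - 1))) integrable_on {0..t}"
    proof -
      have wct: "continuous_on {-1..t} w"
        by (rule continuous_on_subset[OF wc]) (use t in auto)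
      have cont: "continuous_on {0..t} (\<lambda>s. w s + w (s - 1))"
        by (intro continuous_on_add continuous_on_delay[OF wct])
      have "(\<lambda>s. (w s + w (s - 1)) * l s) absolutely_integrable_on {0..t}"
      proof (rule absolutely_integrable_bounded_measurable_product_real)
        show "(\<lambda>s. w s + w (s - 1)) \<in> borel_measurable (lebesgue_on {0..t})"
          by (rule continuous_imp_measurable_on_sets_lebesgue[OF cont]) simp
        show "bounded ((\<lambda>s. w s + w (s - 1)) ` {0..t})"
          by (intro compact_imp_bounded compact_continuous_image cont) simp
        show "l absolutely_integrable_on {0..t}"
          by (rule absolutely_integrable_on_subinterval[OF l(1) sub])
      qed simp
      then show ?thesis by (simp add: absolutely_integrable_on_def mult.commute)
    qed
    have gdiff: "norm (integral {0..t} (\<lambda>s. ?gy s - ?gx s)) \<le> integral {0..t} (\<lambda>s. l s * (w s + w (s - 1)))"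
    proof -
      let ?N = "insert \<tau> N"
      have N': "negligible ?N" using N by (simp add: negligible_insert)
      have "integral {0..t} (\<lambda>s. ?gy s - ?gx s) = integral {0..t} (\<lambda>s. if s \<in> ?N then 0 else ?gy s - ?gx s)"
        by (rule integral_spike[OF N']) auto
      also have "norm \<dots> \<le> integral {0..t} (\<lambda>s. l s * (w s + w (s - 1)))"
      proof (rule Henstock_Kurzweil_Integration.integral_norm_bound_integral[OF _ lw])
        show "(\<lambda>s. if s \<in> ?N then 0 else ?gy s - ?gx s) integrable_on {0..t}"
          using integrable_diff[OF gy(1) gx] N' by (rule integrable_spike) auto
        fix s assume s: "s \<in> {0..t}"
        show "norm (if s \<in> ?N then 0 else ?gy s - ?gx s) \<le> l s * (w s + w (s - 1))"
        proof (cases "s \<in> ?N")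
          case False
          then have s': "0 \<le> s" "s < \<tau>" "s \<notin> N" using s t by auto
          have "norm (?gy s - ?gx s) \<le> l s * norm ((y s, y (s - 1)) - (x s, x (s - 1)))"
            by (intro lipN s' R)
          also have "norm ((y s, y (s - 1)) - (x s, x (s - 1))) \<le> w s + w (s - 1)"
            unfolding w_def by (simp add: norm_Pair_le)
          finally show ?thesis using False l(2)[of s] by (simp add: mult_left_mono)
        qed (simp add: w_def l(2))
      qed
      finally show ?thesis .
    qed
    have eq: "y t - x t = (y 0 - x 0) + integral {0..t} (\<lambda>s. ?gy s - ?gx s) + integral {0..t} (\<lambda>s. ?gx s - ?fx s)"
      using fx(2) gy(2) by (simp add: integral_diff[OF gy(1) gx] integral_diff[OF gx fx(1)])
    have "w t \<le> norm (y 0 - x 0) + norm (integral {0..t} (\<lambda>s. ?gy s - ?gx s)) + norm (integral {0..t} (\<lambda>s. ?gx s - ?fx s))"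
      unfolding w_def eq by (rule order_trans[OF norm_triangle_ineq add_right_mono[OF norm_triangle_ineq]])
    moreover have "norm (y 0 - x 0) \<le> \<eta>"
      using init[of 0] x0[of 0] y0[of 0] by simp
    moreover have "norm (integral {0..t} (\<lambda>s. ?gx s - ?fx s)) \<le> \<eta>"
    proof -
      have "norm (integral {0..t} (\<lambda>s. ?gx s - ?fx s)) \<le> integral {0..t} (\<lambda>s. norm (?gx s - ?fx s))"
        using integrable_diff[OF gx fx(1)] d by (intro Henstock_Kurzweil_Integration.integral_norm_bound_integral) auto
      also have "\<dots> \<le> integral {0..T} (\<lambda>s. norm (?gx s - ?fx s))"
        by (rule integral_subset_le[OF sub d dT]) simp
      finally show ?thesis using path by simp
    qed
    ultimately show "w t \<le> 2 * \<eta> + integral {0..t} (\<lambda>s. l s * (w s + w (s - 1)))"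
      using gdiff by linarith
  qed
  also have "\<dots> \<le> 2 * \<eta> * exp (2 * C)"
  proof -
    have "integral {0..\<tau>} l \<le> integral {0..T} l"
      using \<tau> l(2) l(1) l\<tau> by (intro integral_subset_le) (auto simp: absolutely_integrable_on_def)
    then show ?thesis
      using \<open>0 \<le> \<eta>\<close> l(3) by (intro mult_left_mono) auto
  qed
  finally show ?thesis by (simp add: w_def)
qed

section \<open>First exit and exclusion of blow-up\<close>

text \<open>Self-improvement: distance at most 1 before a time gives, by Gronwall and
  \<open>small\<close>, distance strictly below 1 at that time, so distance 1 is never reached. Then
  \<open>y\<close> stays within \<open>R + 1\<close>, and an end of its interval at or before
  \<open>T\<close> would contradict maximality.\<close>

lemma maximal_dde_solution_close:
  fixes f g :: "'n::finite rhs"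
  assumes x: "dde_solution f \<phi> b x" "f \<in> LC p" "ereal T < b"
    and y: "maximal_dde_solution g \<psi> b' y" "g \<in> LC p"
    and "p \<ge> 1" "0 \<le> T"
    and lip: "integrally_lipschitz g T (2 * R + 2) C" and "0 \<le> C"
    and init: "\<And>t. t \<in> {-1..0} \<Longrightarrow> norm (\<psi> t - \<phi> t) \<le> \<eta>"
    and path: "integral {0..T} (\<lambda>s. norm (g (s, x s, x (s - 1)) - f (s, x s, x (s - 1)))) \<le> \<eta>"
    and R: "\<And>s. s \<in> {-1..T} \<Longrightarrow> norm (x s) \<le> R"
    and small: "2 * \<eta> * exp (2 * C) < 1"
  shows "ereal T < b'" and "\<And>t. t \<in> {-1..T} \<Longrightarrow> norm (y t - x t) \<le> 2 * \<eta> * exp (2 * C)"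
proof -
  have sol: "dde_solution g \<psi> b' y" using y(1) by (simp add: maximal_dde_solution_def)
  have "0 \<le> \<eta>" using order_trans[OF norm_ge_zero init[of 0]] by simp
  have "\<eta> \<le> 2 * \<eta> * exp (2 * C)"
    using \<open>0 \<le> \<eta>\<close> \<open>0 \<le> C\<close> mult_left_mono[of 1 "exp (2 * C)" "2 * \<eta>"] by simp
  then have "\<eta> < 1" using small by simp
  \<comment> \<open>The norm of a pair is at most the sum of the norms of its components, each
    bounded by \<open>R + 1\<close>.\<close>
  have in_ball: "(u, v) \<in> cball 0 (2 * R + 2)" if "norm u \<le> R + 1" "norm v \<le> R + 1" for u v :: "real ^ 'n"
    using norm_Pair_le[of u v] that by simp
  have est: "norm (y t - x t) \<le> 2 * \<eta> * exp (2 * C)"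
    if \<tau>: "0 \<le> \<tau>" "\<tau> \<le> T" "ereal \<tau> < b'" and near: "\<And>s. -1 \<le> s \<Longrightarrow> s < \<tau> \<Longrightarrow> norm (y s - x s) \<le> 1"
      and t: "t \<in> {-1..\<tau>}" for t \<tau>
  proof (rule dde_solution_distance[OF x sol y(2) \<tau>(3) \<open>p \<ge> 1\<close> \<tau>(1,2) lip init path _ _ t])
    have xn: "norm (x s) \<le> R + 1" if "-1 \<le> s" "s < \<tau>" for s
      using R[of s] that \<tau> by auto
    have yn: "norm (y s) \<le> R + 1" if "-1 \<le> s" "s < \<tau>" for s
      using norm_triangle_sub[of "y s" "x s"] near[OF that] R[of s] that \<tau> by auto
    fix s assume "0 \<le> s" "s < \<tau>"
    then show "(x s, x (s - 1)) \<in> cball 0 (2 * R + 2)" "(y s, y (s - 1)) \<in> cball 0 (2 * R + 2)"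
      by (intro in_ball xn yn; simp)+
  qed
  have near: "norm (y t - x t) < 1" if \<tau>: "0 \<le> \<tau>" "\<tau> \<le> T" "ereal \<tau> < b'" and t: "t \<in> {-1..\<tau>}" for t \<tau>
  proof (rule ccontr)
    assume far: "\<not> norm (y t - x t) < 1"
    define S where "S = {s \<in> {-1..\<tau>}. 1 \<le> norm (y s - x s)}"
    have "ereal \<tau> < b" using le_less_trans[OF _ x(3), of "ereal \<tau>"] \<tau> by simp
    then have "continuous_on {-1..\<tau>} (\<lambda>s. norm (y s - x s))"
      by (intro continuous_intros dde_solution_continuous_on[OF x(1)] dde_solution_continuous_on[OF sol] \<tau>)
    then have "closed ({-1..\<tau>} \<inter> (\<lambda>s. norm (y s - x s)) -` {1..})"
      by (rule continuous_closed_preimage) simp_all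
    then have "compact ({-1..\<tau>} \<inter> ({-1..\<tau>} \<inter> (\<lambda>s. norm (y s - x s)) -` {1..}))"
      by (rule compact_Int_closed[OF compact_Icc])
    moreover have "{-1..\<tau>} \<inter> ({-1..\<tau>} \<inter> (\<lambda>s. norm (y s - x s)) -` {1..}) = S"
      by (auto simp: S_def)
    ultimately have "compact S" by simp
    moreover have "S \<noteq> {}" using far t by (auto simp: S_def)
    ultimately obtain \<sigma> where \<sigma>: "\<sigma> \<in> S" "\<And>s. s \<in> S \<Longrightarrow> \<sigma> \<le> s"
      using continuous_attains_inf[of S "\<lambda>s. s"] by auto
    \<comment> \<open>The histories are closer than 1, so the first exit time cannot be negative and
      \<open>est\<close> applies to it.\<close>
    have "norm (y s - x s) < 1" if "s \<in> {-1..0}" for s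
      using init[OF that] x(1) sol that \<open>\<eta> < 1\<close> by (auto simp: dde_solution_def)
    then have "0 \<le> \<sigma>" using \<sigma>(1) by (fastforce simp: S_def)
    have "\<sigma> \<le> \<tau>" using \<sigma>(1) by (simp add: S_def)
    then have "ereal \<sigma> < b'" using le_less_trans[OF _ \<tau>(3), of "ereal \<sigma>"] by simp
    have "norm (y \<sigma> - x \<sigma>) \<le> 2 * \<eta> * exp (2 * C)"
    proof (rule est[of \<sigma>])
      show "norm (y s - x s) \<le> 1" if "-1 \<le> s" "s < \<sigma>" for s
        using \<sigma>(2)[of s] that \<open>\<sigma> \<le> \<tau>\<close> by (force simp: S_def)
    qed (use \<open>0 \<le> \<sigma>\<close> \<open>\<sigma> \<le> \<tau>\<close> \<tau> \<open>ereal \<sigma> < b'\<close> in auto)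
    then show False using \<sigma>(1) small by (simp add: S_def)
  qed
  show "ereal T < b'"
  proof (rule ccontr)
    assume "\<not> ereal T < b'"
    moreover have "0 < b'" using sol by (simp add: dde_solution_def)
    ultimately obtain \<beta> where \<beta>: "b' = ereal \<beta>" "\<beta> \<le> T" "0 < \<beta>"
      by (cases b') auto
    have "norm (y s) \<le> R + 1" if "s \<in> sol_interval (ereal \<beta>)" for s
    proof -
      have s: "-1 \<le> s" "s < \<beta>" using that by (auto simp: sol_interval_def)
      have "norm (y s - x s) < 1"
        \<comment> \<open>\<open>near\<close> asks for a nonnegative horizon, while \<open>s\<close>
          may lie in the history interval.\<close>
        by (rule near[of "max s 0"]) (use s \<beta> in auto)
      then show ?thesis
        using norm_triangle_sub[of "y s" "x s"] R[of s] s \<beta> by auto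
    qed
    then have "bounded (y ` sol_interval (ereal \<beta>))"
      unfolding bounded_iff by blast
    then show False
      using bounded_dde_solution_extends[OF sol[unfolded \<beta>(1)] y(2) \<open>p \<ge> 1\<close>] y(1)
      unfolding maximal_dde_solution_def \<beta>(1) by blast
  qed
  then show "norm (y t - x t) \<le> 2 * \<eta> * exp (2 * C)" if "t \<in> {-1..T}" for t
    using est[of T t] near[of T] that \<open>0 \<le> T\<close> by (simp add: less_imp_le)
qed

text \<open>The supremum over \<open>E\<close> for one large ball and one large interval is finite,
  and it serves as the common mass bound.\<close>

lemma L1_loc_bounded_l_bounds_integrally_lipschitz:
  assumes E: "L1_loc_bounded_l_bounds E" "E \<subseteq> LC p" and "p \<ge> 1" "0 \<le> T"
  obtains C where "0 \<le> C" "\<And>g. g \<in> E \<Longrightarrow> integrally_lipschitz g T R C"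
proof -
  obtain j :: nat where j: "max R 1 \<le> real j" using real_arch_simple by blast
  \<comment> \<open>The half-length \<open>T + 1\<close> is positive even for \<open>T = 0\<close>,
    as the definition of bounded \<open>l\<close>-bounds demands.\<close>
  define S where "S = (SUP f\<in>E. \<integral>\<^sup>+t\<in>{-(T + 1)..T + 1}. opt_l_bound f j t \<partial>lebesgue)"
  have "S < \<infinity>"
    unfolding S_def using \<open>0 \<le> T\<close>
    by (intro E(1)[unfolded L1_loc_bounded_l_bounds_def, rule_format]) simp
  then have S: "S = ennreal (enn2real S)" by simp
  show thesis
  proof (rule that[of "enn2real S"])
    fix g assume g: "g \<in> E"
    have "(\<integral>\<^sup>+t\<in>{-(T + 1)..T + 1}. opt_l_bound g j t \<partial>lebesgue) \<le> S"
      unfolding S_def using g by (rule SUP_upper)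
    then have bound: "(\<integral>\<^sup>+t\<in>{-(T + 1)..T + 1}. opt_l_bound g j t \<partial>lebesgue) \<le> ennreal (enn2real S)"
      using S by simp
    have gLC: "g \<in> LC p" and "0 < j" using g E(2) j by auto
    obtain l N where l: "l absolutely_integrable_on {-(T + 1)..T + 1}" "\<And>t. 0 \<le> l t"
      "integral {-(T + 1)..T + 1} l \<le> enn2real S" and N: "negligible N"
      "\<And>t z1 z2. t \<notin> N \<Longrightarrow> z1 \<in> cball 0 (real j) \<Longrightarrow> z2 \<in> cball 0 (real j) \<Longrightarrow>
        norm (g (t, z1) - g (t, z2)) \<le> l t * norm (z1 - z2)"
      by (rule integrable_optimal_l_bound[OF gLC \<open>p \<ge> 1\<close> \<open>0 < j\<close> enn2real_nonneg bound]) blast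
    have sub: "{0..T} \<subseteq> {-(T + 1)..T + 1}" using \<open>0 \<le> T\<close> by auto
    have l0: "l absolutely_integrable_on {0..T}"
      using l(1) sub by (rule absolutely_integrable_on_subinterval)
    have "integral {0..T} l \<le> integral {-(T + 1)..T + 1} l"
      using l(1,2) l0 by (intro integral_subset_le[OF sub]) (auto simp: absolutely_integrable_on_def)
    then have lC: "integral {0..T} l \<le> enn2real S" using l(3) by simp
    have ball: "z \<in> cball 0 (real j)" if "z \<in> cball 0 R" for z :: "(real ^ 'a) \<times> (real ^ 'a)"
      using that j by simp
    show "integrally_lipschitz g T R (enn2real S)"
      unfolding integrally_lipschitz_def using l0 l(2) lC N ball by blast
  qed simp
qed

text \<open>Solutions and their right endpoints are given data, so the result applies to every
  choice of noncontinuable solutions. Eventual definedness is a separate conjunct, because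
  \<open>uniform_limit\<close> would also accept arbitrary values of \<open>X n\<close> beyond
  \<open>B n\<close>.\<close>

theorem theorem3p5:
  fixes p :: nat
    and D :: "((real ^ 'n::finite) \<times> (real ^ 'n)) set"
    and E :: "'n rhs set"
    and F :: "nat \<Rightarrow> 'n rhs"
    and f :: "'n rhs"
    and \<Phi> :: "nat \<Rightarrow> real \<Rightarrow> real ^ 'n"
    and \<phi> :: "real \<Rightarrow> real ^ 'n"
    and X :: "nat \<Rightarrow> real \<Rightarrow> real ^ 'n"
    and x :: "real \<Rightarrow> real ^ 'n"
    and B :: "nat \<Rightarrow> ereal"
    and b :: ereal
    and T :: real
  assumes "p \<ge> 1"
    and "countable D" and "closure D = UNIV"
    and "E \<subseteq> LC p"
    and "L1_loc_bounded_l_bounds E"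
    and "\<And>n. F n \<in> E"
    and "f \<in> LC p"
    and "limitin (TD_topology p D) F f sequentially"
    and "\<And>n. continuous_on {-1..0} (\<Phi> n)"
    and "continuous_on {-1..0} \<phi>"
    and "uniform_limit {-1..0} \<Phi> \<phi> sequentially"
    and "\<And>n. maximal_dde_solution (F n) (\<Phi> n) (B n) (X n)"
    and "maximal_dde_solution f \<phi> b x"
    and "{-1..T} \<subseteq> sol_interval b"
  shows "(\<forall>\<^sub>F n in sequentially. {-1..T} \<subseteq> sol_interval (B n)) \<and>
         uniform_limit {-1..T} X x sequentially"
proof -
  have FLC: "F n \<in> LC p" for n using assms(4,6) by blast
  have x: "dde_solution f \<phi> b x"
    using assms(13) by (simp add: maximal_dde_solution_def)
  \<comment> \<open>\<open>T\<close> may be negative; then only histories are compared, and the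
    estimates run on \<open>[-1, 0]\<close>.\<close>
  define T' where "T' = max T 0"
  have "0 \<le> T'" "T \<le> T'" by (auto simp: T'_def)
  have T'b: "ereal T' < b"
  proof (cases "0 \<le> T")
    case True
    then have "T \<in> sol_interval b" by (intro subsetD[OF assms(14)]) simp
    then show ?thesis using True by (simp add: T'_def max_absorb1 sol_interval_def)
  next
    case False
    then show ?thesis using x by (simp add: T'_def max_absorb2 dde_solution_def zero_ereal_def)
  qed
  have xc: "continuous_on {-1..T'} x" by (rule dde_solution_continuous_on[OF x T'b])
  then have "bounded (x ` {-1..T'})"
    by (intro compact_imp_bounded compact_continuous_image compact_Icc)
  then obtain R where R: "\<And>s. s \<in> {-1..T'} \<Longrightarrow> norm (x s) \<le> R"
    unfolding bounded_iff by blast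
  have lip: "\<exists>C. \<forall>n. integrally_lipschitz (F n) T' R C" for R
    using L1_loc_bounded_l_bounds_integrally_lipschitz[OF assms(5,4,1) \<open>0 \<le> T'\<close>, of R] assms(6) by metis
  obtain C where C: "0 \<le> C" "\<And>n. integrally_lipschitz (F n) T' (2 * R + 2) C"
    using L1_loc_bounded_l_bounds_integrally_lipschitz[OF assms(5,4,1) \<open>0 \<le> T'\<close>, of "2 * R + 2"] assms(6) by metis
  have sec: "(\<lambda>n. integral {0..T'} (\<lambda>t. norm (F n (t, z) - f (t, z)))) \<longlonglongrightarrow> 0" if "z \<in> D" for z
  proof -
    \<comment> \<open>The seminorms use rational endpoints only; the integral up to
      \<open>T'\<close> is dominated by the one up to a rational \<open>q\<close> beyond it.\<close>
    obtain q where q: "q \<in> \<rat>" "T' < q" using Rats_dense_in_real[of T' "T' + 1"] by auto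
    have hi: "(\<lambda>t. norm (F n (t, z) - f (t, z))) integrable_on {0..a}" for n a
    proof -
      have "(\<lambda>t. h (t, z)) absolutely_integrable_on {0..a}" if "h \<in> LC p" for h :: "'n rhs"
        using LC_compose_absolutely_integrable_continuous[OF that assms(1), of 0 a "\<lambda>_. fst z" "\<lambda>_. snd z"] by simp
      then have "(\<lambda>t. F n (t, z) - f (t, z)) absolutely_integrable_on {0..a}"
        using FLC assms(7) by (intro set_integral_diff(1)) auto
      then show ?thesis by (simp add: absolutely_integrable_on_def)
    qed
    have lim: "(\<lambda>n. integral {0..q} (\<lambda>t. norm (F n (t, z) - f (t, z)))) \<longlonglongrightarrow> 0"
      by (rule tendsto_integral_norm_section[OF assms(8,1,7) FLC _ _ _ that]) (use q \<open>0 \<le> T'\<close> in auto)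
    have nn: "0 \<le> integral {0..T'} (\<lambda>t. norm (F n (t, z) - f (t, z)))" for n
      by (intro Henstock_Kurzweil_Integration.integral_nonneg hi) auto
    have le: "integral {0..T'} (\<lambda>t. norm (F n (t, z) - f (t, z))) \<le> integral {0..q} (\<lambda>t. norm (F n (t, z) - f (t, z)))" for n
      using q by (intro integral_subset_le hi) auto
    show ?thesis
      by (rule tendsto_sandwich[OF _ _ tendsto_const lim]) (simp_all add: nn le)
  qed
  have path: "(\<lambda>n. integral {0..T'} (\<lambda>s. norm (F n (s, x s, x (s - 1)) - f (s, x s, x (s - 1))))) \<longlonglongrightarrow> 0"
    by (rule tendsto_integral_along_path[OF sec assms(7) FLC assms(1,3) \<open>0 \<le> T'\<close> continuous_on_delay(2,1)[OF xc] lip])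
  have main: "\<forall>\<^sub>F n in sequentially. ereal T' < B n \<and> (\<forall>t\<in>{-1..T'}. dist (X n t) (x t) < e)" if "0 < e" for e
  proof -
    \<comment> \<open>Makes the final bound \<open>2 * \<eta> * exp (2 * C)\<close> equal to half of
      \<open>min e 1\<close>: below \<open>e\<close> for convergence and below 1 for the exit
      argument.\<close>
    define \<eta> where "\<eta> = min e 1 / (4 * exp (2 * C))"
    have \<eta>: "0 < \<eta>" using \<open>0 < e\<close> by (simp add: \<eta>_def)
    have small: "2 * \<eta> * exp (2 * C) < e" "2 * \<eta> * exp (2 * C) < 1"
      using \<open>0 < e\<close> by (auto simp: \<eta>_def)
    have "\<forall>\<^sub>F n in sequentially. \<forall>t\<in>{-1..0}. dist (\<Phi> n t) (\<phi> t) < \<eta>"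
      using assms(11) \<eta> by (rule uniform_limitD)
    moreover have "\<forall>\<^sub>F n in sequentially.
        integral {0..T'} (\<lambda>s. norm (F n (s, x s, x (s - 1)) - f (s, x s, x (s - 1)))) < \<eta>"
      using path \<eta> by (rule order_tendstoD(2))
    ultimately show ?thesis
    proof eventually_elim
      case (elim n)
      have init: "norm (\<Phi> n t - \<phi> t) \<le> \<eta>" if "t \<in> {-1..0}" for t
        using elim(1) that by (fastforce simp: dist_norm)
      note close = maximal_dde_solution_close[OF x assms(7) T'b assms(12) FLC assms(1) \<open>0 \<le> T'\<close> C(2) C(1)
          init less_imp_le[OF elim(2)] R small(2)]
      show ?case
        unfolding dist_norm using close(1) le_less_trans[OF close(2) small(1)] by blast
    qed
  qed
  show ?thesis
  proof
    show "\<forall>\<^sub>F n in sequentially. {-1..T} \<subseteq> sol_interval (B n)"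
      using main[OF zero_less_one]
    proof eventually_elim
      case (elim n)
      then have "ereal t < B n" if "t \<le> T" for t
        using that \<open>T \<le> T'\<close> le_less_trans[of "ereal t" "ereal T'" "B n"] by simp
      then show ?case by (auto simp: sol_interval_def)
    qed
    show "uniform_limit {-1..T} X x sequentially"
    proof (rule uniform_limitI)
      fix e :: real assume "0 < e"
      from main[OF this] show "\<forall>\<^sub>F n in sequentially. \<forall>t\<in>{-1..T}. dist (X n t) (x t) < e"
        by eventually_elim (use \<open>T \<le> T'\<close> in auto)
    qed
  qed
qed

end
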